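(* Let $E$ be a finite directed graph and $K$ be any field. Let $p$ be an infinite path in $E$. Then the simple left $L_K(E)$-module $V_{[p]}$ is finitely presented if and only if $p$ is tail-equivalent to the infinite path $ccc\cdots$, where $c$ is some closed path in $E$.
   Context: A directed graph $E=(E^0,E^1,r,s)$ consists of sets $E^0$ (vertices), $E^1$ (edges) and maps $r,s:E^1\to E^0$; here both sets are finite. A vertex is regular if it emits a finite non-zero number of edges. A closed path is a path $e_1\cdots e_n$ ($n\ge1$, $r(e_i)=s(e_{i+1})$) with $r(e_n)=s(e_1)$. $L_K(E)$ (Leavitt path algebra) is the $K$-algebra generated by pairwise orthogonal idempotents $v\in E^0$ and elements $e,e^*$ ($e\in E^1$) with relations: $s(e)e=e=er(e)$; $r(e)e^*=e^*=e^*s(e)$; $e^*e=r(e)$ and $e^*f=0$ for $e\ne f$; $v=\sum_{s(e)=v}ee^*$ for every regular vertex $v$. For an infinite path $p=e_1e_2\cdots$ (with $r(e_i)=s(e_{i+1})$) put $\tau_{>n}(p)=e_{n+1}e_{n+2}\cdots$. Infinite paths $p,q$ are tail-equivalent if $\tau_{>m}(p)=\tau_{>n}(q)$ for some positive integers $m,n$; $[p]$ is the class of $p$. $V_{[p]}$ is the $K$-vector space with basis $[p]$, with left $L_K(E)$-action on $q\in[p]$ given by: $v\cdot q=q$ if $v=s(q)$, else $0$; $e\cdot q=eq$ if $r(e)=s(q)$, else $0$; $e^*\cdot q=\tau_{>1}(q)$ if $q=eq'$, else $0$. It is a simple left $L_K(E)$-module. *)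

theory Defs
  imports
    "HOL-Algebra.QuotRing"
    "HOL-Algebra.Module"
    "HOL-Library.Poly_Mapping"
    "HOL-Library.Stream"
    "Graph_Theory.Arc_Walk"
begin

section \<open>Left modules over a not necessarily commutative ring\<close>

text \<open>The library's module locale requires a commutative base ring; its record type is reused here,
  with the unused ring fields (multiplication and unit of the module) left undefined.\<close>

locale left_module = R?: ring R + M?: abelian_group M
  for R :: "('a, 'm) ring_scheme" (structure) and M :: "('a, 'b, 'n) module_scheme" (structure) +
  assumes smult_closed [simp, intro]:
      "\<lbrakk>a \<in> carrier R; x \<in> carrier M\<rbrakk> \<Longrightarrow> a \<odot>\<^bsub>M\<^esub> x \<in> carrier M"
    and smult_l_distr:
      "\<lbrakk>a \<in> carrier R; b \<in> carrier R; x \<in> carrier M\<rbrakk> \<Longrightarrow>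
       (a \<oplus>\<^bsub>R\<^esub> b) \<odot>\<^bsub>M\<^esub> x = a \<odot>\<^bsub>M\<^esub> x \<oplus>\<^bsub>M\<^esub> b \<odot>\<^bsub>M\<^esub> x"
    and smult_r_distr:
      "\<lbrakk>a \<in> carrier R; x \<in> carrier M; y \<in> carrier M\<rbrakk> \<Longrightarrow>
       a \<odot>\<^bsub>M\<^esub> (x \<oplus>\<^bsub>M\<^esub> y) = a \<odot>\<^bsub>M\<^esub> x \<oplus>\<^bsub>M\<^esub> a \<odot>\<^bsub>M\<^esub> y"
    and smult_assoc1:
      "\<lbrakk>a \<in> carrier R; b \<in> carrier R; x \<in> carrier M\<rbrakk> \<Longrightarrow>
       (a \<otimes>\<^bsub>R\<^esub> b) \<odot>\<^bsub>M\<^esub> x = a \<odot>\<^bsub>M\<^esub> (b \<odot>\<^bsub>M\<^esub> x)"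
    and smult_one [simp]: "x \<in> carrier M \<Longrightarrow> \<one>\<^bsub>R\<^esub> \<odot>\<^bsub>M\<^esub> x = x"

definition left_module_hom ::
  "('a, 'm) ring_scheme \<Rightarrow> ('a, 'b, 'n) module_scheme \<Rightarrow> ('a, 'c, 'o) module_scheme \<Rightarrow> ('b \<Rightarrow> 'c) set"
  where "left_module_hom R M N =
    {h \<in> carrier M \<rightarrow> carrier N.
       (\<forall>x \<in> carrier M. \<forall>y \<in> carrier M. h (x \<oplus>\<^bsub>M\<^esub> y) = h x \<oplus>\<^bsub>N\<^esub> h y) \<and>
       (\<forall>a \<in> carrier R. \<forall>x \<in> carrier M. h (a \<odot>\<^bsub>M\<^esub> x) = a \<odot>\<^bsub>N\<^esub> h x)}"

definition free_left_module :: "('a, 'm) ring_scheme \<Rightarrow> nat \<Rightarrow> ('a, nat \<Rightarrow> 'a) module"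
  where "free_left_module R n =
    \<lparr>carrier = {..<n} \<rightarrow>\<^sub>E carrier R, mult = undefined, one = undefined,
     zero = (\<lambda>i\<in>{..<n}. \<zero>\<^bsub>R\<^esub>), add = (\<lambda>x y. \<lambda>i\<in>{..<n}. x i \<oplus>\<^bsub>R\<^esub> y i),
     smult = (\<lambda>a x. \<lambda>i\<in>{..<n}. a \<otimes>\<^bsub>R\<^esub> x i)\<rparr>"

text \<open>There is an exact sequence \<open>R\<^sup>m \<rightarrow> R\<^sup>n \<rightarrow> M \<rightarrow> 0\<close> of left modules.\<close>

definition finitely_presented :: "('a, 'm) ring_scheme \<Rightarrow> ('a, 'b, 'n) module_scheme \<Rightarrow> bool"
  where "finitely_presented R M \<longleftrightarrow>
    (\<exists>m n. \<exists>g \<in> left_module_hom R (free_left_module R m) (free_left_module R n).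
       \<exists>f \<in> left_module_hom R (free_left_module R n) M.
         f ` carrier (free_left_module R n) = carrier M \<and>
         g ` carrier (free_left_module R m) = {x \<in> carrier (free_left_module R n). f x = \<zero>\<^bsub>M\<^esub>})"


section \<open>Free associative algebras\<close>

text \<open>Words under concatenation, written additively so that the convolution product of
  \<open>Poly_Mapping\<close> makes \<open>'g free_monoid \<Rightarrow>\<^sub>0 'k\<close> the free unital associative \<open>'k\<close>-algebra on \<open>'g\<close>.\<close>

datatype 'g free_monoid = Wd (letters: "'g list")

instantiation free_monoid :: (type) monoid_add
begin

definition zero_free_monoid :: "'a free_monoid" where "0 = Wd []"

definition plus_free_monoid :: "'a free_monoid \<Rightarrow> 'a free_monoid \<Rightarrow> 'a free_monoid"
  where "u + w = Wd (letters u @ letters w)"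

instance
  by standard (simp_all add: zero_free_monoid_def plus_free_monoid_def)

end

lemma letters_plus [simp]: "letters (u + w) = letters u @ letters w"
  by (simp add: plus_free_monoid_def)

lemma letters_zero [simp]: "letters 0 = []"
  by (simp add: zero_free_monoid_def)

definition free_algebra :: "'g set \<Rightarrow> ('g free_monoid \<Rightarrow>\<^sub>0 'k::field) ring"
  where "free_algebra X =
    \<lparr>carrier = {f. \<forall>w \<in> Poly_Mapping.keys f. set (letters w) \<subseteq> X},
     mult = (*), one = 1, zero = 0, add = (+)\<rparr>"


section \<open>Leavitt path algebras\<close>

text \<open>Graphs are the library's digraphs (loops and parallel edges allowed): \<open>verts E\<close> is \<open>E\<^sup>0\<close>,
  \<open>arcs E\<close> is \<open>E\<^sup>1\<close>, \<open>tail E\<close> is the source map \<open>s\<close> and \<open>head E\<close> is the range map \<open>r\<close>.\<close>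

datatype ('v, 'e) lpa_gen = Vertex 'v | Edge 'e | Ghost 'e

type_synonym ('v, 'e, 'k) lpa_free = "('v, 'e) lpa_gen free_monoid \<Rightarrow>\<^sub>0 'k"

definition lpa_gens :: "('v, 'e) pre_digraph \<Rightarrow> ('v, 'e) lpa_gen set"
  where "lpa_gens E = Vertex ` verts E \<union> Edge ` arcs E \<union> Ghost ` arcs E"

definition gen :: "('v, 'e) lpa_gen \<Rightarrow> ('v, 'e, 'k::field) lpa_free"
  where "gen x = Poly_Mapping.single (Wd [x]) 1"

definition regular_vertex :: "('v, 'e) pre_digraph \<Rightarrow> 'v \<Rightarrow> bool"
  where "regular_vertex E v \<longleftrightarrow> v \<in> verts E \<and> finite (out_arcs E v) \<and> out_arcs E v \<noteq> {}"

text \<open>Each element \<open>a - b\<close> stands for the defining relation \<open>a = b\<close>.\<close>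

definition lpa_relations :: "('v, 'e) pre_digraph \<Rightarrow> ('v, 'e, 'k::field) lpa_free set"
  where "lpa_relations E =
      {gen (Vertex v) * gen (Vertex v) - gen (Vertex v) | v. v \<in> verts E}
    \<union> {gen (Vertex v) * gen (Vertex w) | v w. v \<in> verts E \<and> w \<in> verts E \<and> v \<noteq> w}
    \<union> {gen (Vertex (tail E e)) * gen (Edge e) - gen (Edge e) | e. e \<in> arcs E}
    \<union> {gen (Edge e) * gen (Vertex (head E e)) - gen (Edge e) | e. e \<in> arcs E}
    \<union> {gen (Vertex (head E e)) * gen (Ghost e) - gen (Ghost e) | e. e \<in> arcs E}
    \<union> {gen (Ghost e) * gen (Vertex (tail E e)) - gen (Ghost e) | e. e \<in> arcs E}
    \<union> {gen (Ghost e) * gen (Edge e) - gen (Vertex (head E e)) | e. e \<in> arcs E}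
    \<union> {gen (Ghost e) * gen (Edge f) | e f. e \<in> arcs E \<and> f \<in> arcs E \<and> e \<noteq> f}
    \<union> {gen (Vertex v) - (\<Sum>e \<in> out_arcs E v. gen (Edge e) * gen (Ghost e)) | v. regular_vertex E v}"

abbreviation lpa_ideal :: "('v, 'e) pre_digraph \<Rightarrow> ('v, 'e, 'k::field) lpa_free set"
  where "lpa_ideal E \<equiv> Idl\<^bsub>free_algebra (lpa_gens E)\<^esub> (lpa_relations E)"

text \<open>The presentation is one of associative, not necessarily unital algebras: the elements are the
  classes of those elements of the free algebra that have no constant term (all relations
  are among these, and the ideal they generate is the same in the free algebra with or without unit).
  For a finite graph the quotient has an identity element, the sum of all vertices.\<close>

definition leavitt_path_algebra ::
  "('v, 'e) pre_digraph \<Rightarrow> (('v, 'e, 'k::field) lpa_free set) ring"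
  where "leavitt_path_algebra E =
    (free_algebra (lpa_gens E) Quot lpa_ideal E)
      \<lparr>carrier := (\<lambda>f. lpa_ideal E +>\<^bsub>free_algebra (lpa_gens E)\<^esub> f) `
          {f \<in> carrier (free_algebra (lpa_gens E)). Poly_Mapping.lookup f 0 = 0},
       one := lpa_ideal E +>\<^bsub>free_algebra (lpa_gens E)\<^esub> (\<Sum>v \<in> verts E. gen (Vertex v))\<rparr>"


section \<open>Infinite paths and the module of a tail-equivalence class\<close>

definition infinite_paths :: "('v, 'e) pre_digraph \<Rightarrow> 'e stream set"
  where "infinite_paths E =
    {p. \<forall>i. p !! i \<in> arcs E \<and> head E (p !! i) = tail E (p !! Suc i)}"

definition tail_equivalent :: "'e stream \<Rightarrow> 'e stream \<Rightarrow> bool"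
  where "tail_equivalent p q \<longleftrightarrow> (\<exists>m>0. \<exists>n>0. sdrop m p = sdrop n q)"

definition tail_class :: "('v, 'e) pre_digraph \<Rightarrow> 'e stream \<Rightarrow> 'e stream set"
  where "tail_class E p = {q \<in> infinite_paths E. tail_equivalent p q}"

text \<open>A generator sends a path to a path (\<open>Some\<close>) or to zero (\<open>None\<close>).\<close>

fun gen_act :: "('v, 'e) pre_digraph \<Rightarrow> ('v, 'e) lpa_gen \<Rightarrow> 'e stream \<Rightarrow> 'e stream option"
  where
    "gen_act E (Vertex v) q = (if v = tail E (shd q) then Some q else None)"
  | "gen_act E (Edge e) q = (if head E e = tail E (shd q) then Some (e ## q) else None)"
  | "gen_act E (Ghost e) q = (if shd q = e then Some (stl q) else None)"

primrec word_act :: "('v, 'e) pre_digraph \<Rightarrow> ('v, 'e) lpa_gen list \<Rightarrow> 'e stream \<Rightarrow> 'e stream option"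
  where
    "word_act E [] q = Some q"
  | "word_act E (g # gs) q = Option.bind (word_act E gs q) (gen_act E g)"

text \<open>The bilinear extension to the free algebra and finite linear combinations of paths.\<close>

definition free_act ::
  "('v, 'e) pre_digraph \<Rightarrow> ('v, 'e, 'k::field) lpa_free \<Rightarrow> ('e stream \<Rightarrow>\<^sub>0 'k) \<Rightarrow> ('e stream \<Rightarrow>\<^sub>0 'k)"
  where "free_act E f x =
    (\<Sum>w \<in> Poly_Mapping.keys f. \<Sum>q \<in> Poly_Mapping.keys x.
      case word_act E (letters w) q of
        None \<Rightarrow> 0
      | Some q' \<Rightarrow> Poly_Mapping.single q' (Poly_Mapping.lookup f w * Poly_Mapping.lookup x q))"

text \<open>The class of \<open>f\<close> acts as \<open>f\<close> does; see \<open>path_module_smult\<close> below for independence of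
  the representative.\<close>

definition path_module ::
  "('v, 'e) pre_digraph \<Rightarrow> 'e stream \<Rightarrow> (('v, 'e, 'k::field) lpa_free set, 'e stream \<Rightarrow>\<^sub>0 'k) module"
  where "path_module E p =
    \<lparr>carrier = {x. Poly_Mapping.keys x \<subseteq> tail_class E p}, mult = undefined, one = undefined,
     zero = 0, add = (+),
     smult = (\<lambda>X x. the_elem ((\<lambda>f. free_act E f x) ` X))\<rparr>"


section \<open>Well-definedness\<close>

subsection \<open>The free algebra\<close>

lemma free_algebra_simps [simp]:
  "mult (free_algebra X) = (*)" "one (free_algebra X) = 1"
  "zero (free_algebra X) = 0" "add (free_algebra X) = (+)"
  by (simp_all add: free_algebra_def)

lemma free_algebra_carrier:
  "f \<in> carrier (free_algebra X) \<longleftrightarrow> (\<forall>w \<in> Poly_Mapping.keys f. set (letters w) \<subseteq> X)"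
  by (simp add: free_algebra_def)

lemma keys_uminus': "Poly_Mapping.keys (- f) = Poly_Mapping.keys (f :: 'a \<Rightarrow>\<^sub>0 'b::ab_group_add)"
  by (auto simp: in_keys_iff)

lemma free_algebra_add:
  "\<lbrakk>f \<in> carrier (free_algebra X); g \<in> carrier (free_algebra X)\<rbrakk> \<Longrightarrow> f + g \<in> carrier (free_algebra X)"
  using keys_add[of f g] by (fastforce simp: free_algebra_carrier)

lemma free_algebra_uminus:
  "f \<in> carrier (free_algebra X) \<Longrightarrow> - f \<in> carrier (free_algebra X)"
  by (simp add: free_algebra_carrier keys_uminus')

lemma free_algebra_diff:
  "\<lbrakk>f \<in> carrier (free_algebra X); g \<in> carrier (free_algebra X)\<rbrakk> \<Longrightarrow> f - g \<in> carrier (free_algebra X)"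
  using free_algebra_add[of f X "- g"] free_algebra_uminus[of g X] by simp

lemma free_algebra_mult:
  "\<lbrakk>f \<in> carrier (free_algebra X); g \<in> carrier (free_algebra X)\<rbrakk> \<Longrightarrow> f * g \<in> carrier (free_algebra X)"
  using keys_mult[of f g] by (fastforce simp: free_algebra_carrier)

lemma free_algebra_sum:
  "(\<And>i. i \<in> A \<Longrightarrow> h i \<in> carrier (free_algebra X)) \<Longrightarrow> sum h A \<in> carrier (free_algebra X)"
proof (induction A rule: infinite_finite_induct)
  case (insert a A)
  then show ?case by (simp add: free_algebra_add)
qed (simp_all add: free_algebra_carrier)

lemma ring_free_algebra: "ring (free_algebra X :: ('g free_monoid \<Rightarrow>\<^sub>0 'k::field) ring)"
proof (rule ringI)
  show "abelian_group (free_algebra X :: ('g free_monoid \<Rightarrow>\<^sub>0 'k) ring)"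
  proof (rule abelian_groupI)
    fix f :: "'g free_monoid \<Rightarrow>\<^sub>0 'k"
    assume "f \<in> carrier (free_algebra X)"
    then show "\<exists>g\<in>carrier (free_algebra X). g \<oplus>\<^bsub>free_algebra X\<^esub> f = \<zero>\<^bsub>free_algebra X\<^esub>"
      by (intro bexI[of _ "- f"]) (simp_all add: free_algebra_uminus)
  qed (simp_all add: free_algebra_add add_ac, simp add: free_algebra_carrier)
  show "Group.monoid (free_algebra X :: ('g free_monoid \<Rightarrow>\<^sub>0 'k) ring)"
    by (rule monoidI) (simp_all add: free_algebra_mult mult.assoc, simp add: free_algebra_carrier)
qed (simp_all add: distrib_left distrib_right)

lemma gen_in_free_algebra [simp]:
  "gen x \<in> carrier (free_algebra (lpa_gens E)) \<longleftrightarrow> x \<in> lpa_gens E"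
  by (simp add: free_algebra_carrier gen_def)

lemma lpa_gens_simps [simp]:
  "Vertex v \<in> lpa_gens E \<longleftrightarrow> v \<in> verts E" "Edge e \<in> lpa_gens E \<longleftrightarrow> e \<in> arcs E"
  "Ghost e \<in> lpa_gens E \<longleftrightarrow> e \<in> arcs E"
  by (auto simp: lpa_gens_def)


subsection \<open>The Leavitt path algebra is a ring\<close>

lemma lpa_relations_subset:
  assumes "wf_digraph E"
  shows "lpa_relations E \<subseteq> carrier (free_algebra (lpa_gens E))"
proof -
  interpret wf_digraph E by fact
  have sum_in: "(\<Sum>e \<in> out_arcs E v. gen (Edge e) * gen (Ghost e)) \<in> carrier (free_algebra (lpa_gens E))" for v
    by (intro free_algebra_sum free_algebra_mult) (auto simp: out_arcs_def)
  show ?thesis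
    unfolding lpa_relations_def
    by (auto simp: regular_vertex_def intro!: free_algebra_diff free_algebra_mult sum_in)
qed

lemma ideal_lpa_ideal:
  assumes "wf_digraph E"
  shows "ideal (lpa_ideal E) (free_algebra (lpa_gens E))"
  by (rule ring.genideal_ideal[OF ring_free_algebra lpa_relations_subset[OF assms]])

lemma lpa_relations_in_ideal:
  assumes "wf_digraph E" "r \<in> lpa_relations E"
  shows "r \<in> lpa_ideal E"
  using ring.genideal_self[OF ring_free_algebra lpa_relations_subset[OF assms(1)]] assms(2) by blast

abbreviation lpa_class :: "('v, 'e) pre_digraph \<Rightarrow> ('v, 'e, 'k::field) lpa_free \<Rightarrow> ('v, 'e, 'k) lpa_free set"
  where "lpa_class E f \<equiv> lpa_ideal E +>\<^bsub>free_algebra (lpa_gens E)\<^esub> f"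

definition augmentation :: "('v, 'e) pre_digraph \<Rightarrow> ('v, 'e, 'k::field) lpa_free set"
  where "augmentation E = {f \<in> carrier (free_algebra (lpa_gens E)). Poly_Mapping.lookup f 0 = 0}"

lemma augmentationD: "f \<in> augmentation E \<Longrightarrow> f \<in> carrier (free_algebra (lpa_gens E))"
  by (simp add: augmentation_def)

lemma carrier_lpa: "carrier (leavitt_path_algebra E) = lpa_class E ` augmentation E"
  by (simp add: leavitt_path_algebra_def augmentation_def)

lemma one_lpa: "\<one>\<^bsub>leavitt_path_algebra E\<^esub> = lpa_class E (\<Sum>v \<in> verts E. gen (Vertex v))"
  by (simp add: leavitt_path_algebra_def)

lemma zero_lpa:
  assumes "wf_digraph E"
  shows "\<zero>\<^bsub>leavitt_path_algebra E\<^esub> = (lpa_class E 0 :: ('v, 'e, 'k::field) lpa_free set)"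
proof -
  interpret ideal "lpa_ideal E :: ('v, 'e, 'k) lpa_free set" "free_algebra (lpa_gens E)"
    by (rule ideal_lpa_ideal[OF assms])
  have "lpa_class E \<zero>\<^bsub>free_algebra (lpa_gens E)\<^esub> = (lpa_ideal E :: ('v, 'e, 'k) lpa_free set)"
    by (rule a_rcos_zero) (use is_ideal additive_subgroup.zero_closed[OF is_additive_subgroup] in simp_all)
  then show ?thesis by (simp add: leavitt_path_algebra_def FactRing_def)
qed

lemma add_lpa:
  assumes "wf_digraph E" "f \<in> augmentation E" "g \<in> augmentation E"
  shows "lpa_class E f \<oplus>\<^bsub>leavitt_path_algebra E\<^esub> lpa_class E g = lpa_class E (f + g)"
proof -
  interpret ideal "lpa_ideal E" "free_algebra (lpa_gens E)" by (rule ideal_lpa_ideal[OF assms(1)])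
  show ?thesis
    using a_rcos_sum[of f g] assms(2,3)
    by (simp add: leavitt_path_algebra_def FactRing_def augmentation_def)
qed

lemma mult_lpa:
  assumes "wf_digraph E" "f \<in> augmentation E" "g \<in> augmentation E"
  shows "lpa_class E f \<otimes>\<^bsub>leavitt_path_algebra E\<^esub> lpa_class E g = lpa_class E (f * g)"
proof -
  interpret ideal "lpa_ideal E" "free_algebra (lpa_gens E)" by (rule ideal_lpa_ideal[OF assms(1)])
  show ?thesis
    using rcoset_mult_add[of f g] assms(2,3)
    by (simp add: leavitt_path_algebra_def FactRing_def augmentation_def)
qed

lemma lookup_mult_zero:
  "Poly_Mapping.lookup (f * g) 0 = Poly_Mapping.lookup f 0 * Poly_Mapping.lookup (g :: 'g free_monoid \<Rightarrow>\<^sub>0 'k::field) 0"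
proof -
  have split: "(0 :: 'g free_monoid) = u + w \<longleftrightarrow> u = 0 \<and> w = 0" for u w
    by (cases u; cases w) (auto simp: zero_free_monoid_def plus_free_monoid_def)
  have "(\<Sum>w. Poly_Mapping.lookup g w when (0 :: 'g free_monoid) = u + w) = (Poly_Mapping.lookup g 0 when u = 0)" for u
    by (cases "u = 0") (simp_all add: split)
  then show ?thesis
    by (simp add: lookup_mult mult_when)
qed

lemma augmentation_closed:
  "0 \<in> augmentation E"
  "f \<in> augmentation E \<Longrightarrow> g \<in> augmentation E \<Longrightarrow> f + g \<in> augmentation E"
  "f \<in> augmentation E \<Longrightarrow> - f \<in> augmentation E"
  "f \<in> augmentation E \<Longrightarrow> g \<in> augmentation E \<Longrightarrow> f * g \<in> augmentation E"
  by (auto simp: augmentation_def free_algebra_add free_algebra_uminus free_algebra_mult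
      lookup_add lookup_mult_zero) (simp add: free_algebra_carrier)

lemma augmentation_sum:
  "(\<And>i. i \<in> A \<Longrightarrow> h i \<in> augmentation E) \<Longrightarrow> sum h A \<in> augmentation E"
  by (induction A rule: infinite_finite_induct) (simp_all add: augmentation_closed)

lemma augmentation_gen: "x \<in> lpa_gens E \<Longrightarrow> gen x \<in> augmentation E"
  by (simp add: augmentation_def) (simp add: gen_def lookup_single zero_free_monoid_def)

lemma poly_mapping_expand:
  "(\<Sum>w \<in> Poly_Mapping.keys f. Poly_Mapping.single w (Poly_Mapping.lookup f w)) = f"
  by (rule poly_mapping_eqI) (auto simp: lookup_sum lookup_single when_def in_keys_iff sum.delta)

lemma lpa_ideal_closed:
  assumes "wf_digraph E"
  shows "0 \<in> lpa_ideal E"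
    "\<lbrakk>f \<in> lpa_ideal E; g \<in> lpa_ideal E\<rbrakk> \<Longrightarrow> f + g \<in> lpa_ideal E"
    "\<lbrakk>f \<in> lpa_ideal E; g \<in> carrier (free_algebra (lpa_gens E))\<rbrakk> \<Longrightarrow> f * g \<in> lpa_ideal E"
    "\<lbrakk>f \<in> lpa_ideal E; g \<in> carrier (free_algebra (lpa_gens E))\<rbrakk> \<Longrightarrow> g * f \<in> lpa_ideal E"
proof -
  interpret ideal "lpa_ideal E" "free_algebra (lpa_gens E)" by (rule ideal_lpa_ideal[OF assms])
  show "0 \<in> lpa_ideal E" using additive_subgroup.zero_closed[OF is_additive_subgroup] by simp
  show "f + g \<in> lpa_ideal E" if "f \<in> lpa_ideal E" "g \<in> lpa_ideal E"
    using additive_subgroup.a_closed[OF is_additive_subgroup that] by simp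
  show "f * g \<in> lpa_ideal E" if "f \<in> lpa_ideal E" "g \<in> carrier (free_algebra (lpa_gens E))"
    using I_r_closed[OF that] by simp
  show "g * f \<in> lpa_ideal E" if "f \<in> lpa_ideal E" "g \<in> carrier (free_algebra (lpa_gens E))"
    using I_l_closed[OF that] by simp
qed

lemma lpa_ideal_sum:
  assumes "wf_digraph E" "\<And>i. i \<in> A \<Longrightarrow> h i \<in> lpa_ideal E"
  shows "sum h A \<in> lpa_ideal E"
  using assms(2)
  by (induction A rule: infinite_finite_induct) (simp_all add: lpa_ideal_closed[OF assms(1)])

lemma lpa_class_eqI:
  assumes "wf_digraph E" "f \<in> carrier (free_algebra (lpa_gens E))"
    "g \<in> carrier (free_algebra (lpa_gens E))" "f - g \<in> lpa_ideal E"
  shows "lpa_class E f = lpa_class E g"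
proof -
  interpret ideal "lpa_ideal E" "free_algebra (lpa_gens E)" by (rule ideal_lpa_ideal[OF assms(1)])
  have "f = (f - g) + g" by simp
  then have "f \<in> lpa_class E g"
    using assms(4) unfolding a_r_coset_def' by (auto intro!: bexI[of _ "f - g"])
  then show ?thesis
    by (rule a_repr_independence'[OF _ assms(3), symmetric])
qed

lemma vertex_sum_gen:
  fixes E :: "('v, 'e) pre_digraph"
  defines "g \<equiv> gen :: _ \<Rightarrow> ('v, 'e, 'k::field) lpa_free"
  assumes fin: "fin_digraph E" and x: "x \<in> lpa_gens E"
  shows "(\<Sum>v \<in> verts E. g (Vertex v)) * g x - g x \<in> lpa_ideal E"
    and "g x * (\<Sum>v \<in> verts E. g (Vertex v)) - g x \<in> lpa_ideal E"
proof -
  interpret fin_digraph E by (rule fin)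
  note cl = lpa_ideal_closed[OF wf_digraph_axioms]
  have rel: "r \<in> lpa_relations E \<Longrightarrow> r \<in> lpa_ideal E" for r
    by (rule lpa_relations_in_ideal[OF wf_digraph_axioms])
  have orth: "g (Vertex v) * g (Vertex w) \<in> lpa_ideal E"
    if "v \<in> verts E" "w \<in> verts E" "v \<noteq> w" for v w
    by (rule rel) (use that in \<open>auto simp: lpa_relations_def g_def\<close>)
  have gen_in: "g x \<in> carrier (free_algebra (lpa_gens E))" using x by (simp add: g_def)
  have neg: "- f \<in> lpa_ideal E" if "f \<in> lpa_ideal E" for f
    using cl(3)[OF that, of "- 1"] by (simp add: free_algebra_carrier keys_uminus')
  have L: "\<exists>u \<in> verts E. g (Vertex u) * g x - g x \<in> lpa_ideal E"
  proof (cases x)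
    case (Vertex v) then show ?thesis using x
      by (intro bexI[of _ v] rel) (auto simp: lpa_relations_def g_def)
  next
    case (Edge e) then show ?thesis using x
      by (intro bexI[of _ "tail E e"] rel) (auto simp: lpa_relations_def g_def)
  next
    case (Ghost e) then show ?thesis using x
      by (intro bexI[of _ "head E e"] rel) (auto simp: lpa_relations_def g_def)
  qed
  have R: "\<exists>u \<in> verts E. g x * g (Vertex u) - g x \<in> lpa_ideal E"
  proof (cases x)
    case (Vertex v) then show ?thesis using x
      by (intro bexI[of _ v] rel) (auto simp: lpa_relations_def g_def)
  next
    case (Edge e) then show ?thesis using x
      by (intro bexI[of _ "head E e"] rel) (auto simp: lpa_relations_def g_def)
  next
    case (Ghost e) then show ?thesis using x
      by (intro bexI[of _ "tail E e"] rel) (auto simp: lpa_relations_def g_def)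
  qed
  obtain u where u: "u \<in> verts E" "g (Vertex u) * g x - g x \<in> lpa_ideal E"
    using L by blast
  have "g (Vertex v) * g x \<in> lpa_ideal E" if "v \<in> verts E - {u}" for v
  proof -
    have "g (Vertex v) * g x =
        g (Vertex v) * g (Vertex u) * g x + g (Vertex v) * - (g (Vertex u) * g x - g x)"
      by (simp add: algebra_simps)
    also have "\<dots> \<in> lpa_ideal E"
      by (intro cl(2) cl(3)[OF orth] cl(4)[OF neg[OF u(2)]]) (use that u gen_in in \<open>auto simp: g_def\<close>)
    finally show ?thesis .
  qed
  then have "(\<Sum>v \<in> verts E - {u}. g (Vertex v) * g x) \<in> lpa_ideal E"
    by (rule lpa_ideal_sum[OF wf_digraph_axioms])
  from cl(2)[OF u(2) this] show "(\<Sum>v \<in> verts E. g (Vertex v)) * g x - g x \<in> lpa_ideal E"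
    by (simp add: sum_distrib_right distrib_right diff_add_eq sum.remove[OF finite_verts u(1)])
  obtain u where u: "u \<in> verts E" "g x * g (Vertex u) - g x \<in> lpa_ideal E"
    using R by blast
  have "g x * g (Vertex v) \<in> lpa_ideal E" if "v \<in> verts E - {u}" for v
  proof -
    have "g x * g (Vertex v) =
        g x * (g (Vertex u) * g (Vertex v)) + - (g x * g (Vertex u) - g x) * g (Vertex v)"
      by (simp add: algebra_simps)
    also have "\<dots> \<in> lpa_ideal E"
      by (intro cl(2) cl(4)[OF orth] cl(3)[OF neg[OF u(2)]]) (use that u gen_in in \<open>auto simp: g_def\<close>)
    finally show ?thesis .
  qed
  then have "(\<Sum>v \<in> verts E - {u}. g x * g (Vertex v)) \<in> lpa_ideal E"
    by (rule lpa_ideal_sum[OF wf_digraph_axioms])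
  from cl(2)[OF u(2) this] show "g x * (\<Sum>v \<in> verts E. g (Vertex v)) - g x \<in> lpa_ideal E"
    by (simp add: sum_distrib_left distrib_left diff_add_eq sum.remove[OF finite_verts u(1)])
qed

lemma vertex_sum_unit:
  assumes "fin_digraph E" "f \<in> augmentation E"
  shows "(\<Sum>v \<in> verts E. gen (Vertex v)) * f - f \<in> lpa_ideal E"
    and "f * (\<Sum>v \<in> verts E. gen (Vertex v)) - f \<in> lpa_ideal E"
proof -
  interpret fin_digraph E by fact
  note cl = lpa_ideal_closed[OF wf_digraph_axioms]
  let ?s = "\<Sum>v \<in> verts E. gen (Vertex v) :: ('a, 'b, 'c) lpa_free"
  let ?t = "\<lambda>w. Poly_Mapping.single w (Poly_Mapping.lookup f w)"
  have w: "?s * ?t w - ?t w \<in> lpa_ideal E \<and> ?t w * ?s - ?t w \<in> lpa_ideal E"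
    if "w \<in> Poly_Mapping.keys f" for w
  proof -
    have ne: "letters w \<noteq> []"
    proof
      assume "letters w = []"
      then have "w = 0" by (cases w) (simp add: zero_free_monoid_def)
      with that assms(2) show False by (simp add: augmentation_def in_keys_iff)
    qed
    have sub: "set (letters w) \<subseteq> lpa_gens E"
      using that assms(2) by (auto simp: augmentation_def free_algebra_carrier)
    define a where "a = Poly_Mapping.lookup f w"
    define l where "l = (Poly_Mapping.single (Wd (tl (letters w))) a :: ('a, 'b, 'c) lpa_free)"
    define r where "r = (Poly_Mapping.single (Wd (butlast (letters w))) a :: ('a, 'b, 'c) lpa_free)"
    have in_l: "l \<in> carrier (free_algebra (lpa_gens E))"
      using sub ne by (auto simp: l_def free_algebra_carrier dest: list.set_sel(2))
    have in_r: "r \<in> carrier (free_algebra (lpa_gens E))"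
      using sub ne by (auto simp: r_def free_algebra_carrier dest: in_set_butlastD)
    have eq_l: "?t w = gen (hd (letters w)) * l"
      using ne by (cases w) (simp add: gen_def l_def a_def mult_single plus_free_monoid_def)
    have eq_r: "?t w = r * gen (last (letters w))"
      using ne by (cases w) (simp add: gen_def r_def a_def mult_single plus_free_monoid_def)
    have "?s * ?t w - ?t w = (?s * gen (hd (letters w)) - gen (hd (letters w))) * l"
      unfolding eq_l by (simp add: algebra_simps)
    moreover have "\<dots> \<in> lpa_ideal E"
      using sub ne by (intro cl(3)[OF vertex_sum_gen(1)] assms(1) in_l) auto
    moreover have "?t w * ?s - ?t w = r * (gen (last (letters w)) * ?s - gen (last (letters w)))"
      unfolding eq_r by (simp add: algebra_simps)
    moreover have "\<dots> \<in> lpa_ideal E"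
      using sub ne by (intro cl(4)[OF vertex_sum_gen(2)] assms(1) in_r) auto
    ultimately show ?thesis by simp
  qed
  have e: "f = (\<Sum>w \<in> Poly_Mapping.keys f. ?t w)" by (simp add: poly_mapping_expand)
  have "?s * f - f = (\<Sum>w \<in> Poly_Mapping.keys f. ?s * ?t w - ?t w)"
    by (subst (1 2) e) (simp only: sum_distrib_left sum_subtractf)
  then show "?s * f - f \<in> lpa_ideal E"
    using lpa_ideal_sum[OF wf_digraph_axioms, of _ "\<lambda>w. ?s * ?t w - ?t w"] w by simp
  have "f * ?s - f = (\<Sum>w \<in> Poly_Mapping.keys f. ?t w * ?s - ?t w)"
    by (subst (1 2) e) (simp only: sum_distrib_right sum_subtractf)
  then show "f * ?s - f \<in> lpa_ideal E"
    using lpa_ideal_sum[OF wf_digraph_axioms, of _ "\<lambda>w. ?t w * ?s - ?t w"] w by simp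
qed

lemma vertex_sum_augmentation: "(\<Sum>v \<in> verts E. gen (Vertex v)) \<in> augmentation E"
  by (intro augmentation_sum augmentation_gen) simp

lemma ring_leavitt_path_algebra:
  assumes "fin_digraph E"
  shows "ring (leavitt_path_algebra E :: (('v, 'e, 'k::field) lpa_free set) ring)" (is "ring ?L")
proof -
  interpret fin_digraph E by fact
  note ops = add_lpa[OF wf_digraph_axioms] mult_lpa[OF wf_digraph_axioms] zero_lpa[OF wf_digraph_axioms]
    one_lpa augmentation_closed vertex_sum_augmentation
  have unit: "lpa_class E ((\<Sum>v \<in> verts E. gen (Vertex v)) * f) = lpa_class E f"
     "lpa_class E (f * (\<Sum>v \<in> verts E. gen (Vertex v))) = lpa_class E f"
    if "f \<in> augmentation E" for f :: "('v, 'e, 'k) lpa_free"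
  proof -
    have mem: "f \<in> carrier (free_algebra (lpa_gens E))"
      "(\<Sum>v \<in> verts E. gen (Vertex v)) \<in> carrier (free_algebra (lpa_gens E) :: ('v, 'e, 'k) lpa_free ring)"
      using augmentationD[OF that] augmentationD[OF vertex_sum_augmentation] by blast+
    show "lpa_class E ((\<Sum>v \<in> verts E. gen (Vertex v)) * f) = lpa_class E f"
      by (rule lpa_class_eqI[OF wf_digraph_axioms _ _ vertex_sum_unit(1)[OF assms that]])
        (intro free_algebra_mult mem)+
    show "lpa_class E (f * (\<Sum>v \<in> verts E. gen (Vertex v))) = lpa_class E f"
      by (rule lpa_class_eqI[OF wf_digraph_axioms _ _ vertex_sum_unit(2)[OF assms that]])
        (intro free_algebra_mult mem)+
  qed
  show ?thesis
  proof (rule ringI)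
    show "abelian_group ?L"
    proof (rule abelian_groupI)
      fix x assume "x \<in> carrier ?L"
      then obtain f :: "('v, 'e, 'k) lpa_free" where "f \<in> augmentation E" "x = lpa_class E f"
        unfolding carrier_lpa by blast
      then show "\<exists>y\<in>carrier ?L. y \<oplus>\<^bsub>?L\<^esub> x = \<zero>\<^bsub>?L\<^esub>"
        by (intro bexI[of _ "lpa_class E (- f)"]) (auto simp: carrier_lpa ops)
    qed (auto simp: carrier_lpa ops add_ac)
    show "Group.monoid ?L"
      by (rule monoidI) (auto simp: carrier_lpa ops unit mult.assoc)
  qed (auto simp: carrier_lpa ops distrib_left distrib_right)
qed


subsection \<open>The action on paths\<close>

lemma free_act_superset:
  assumes "finite W" "Poly_Mapping.keys f \<subseteq> W" "finite Q" "Poly_Mapping.keys x \<subseteq> Q"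
  shows "free_act E f x =
    (\<Sum>w \<in> W. \<Sum>q \<in> Q. case word_act E (letters w) q of
        None \<Rightarrow> 0
      | Some q' \<Rightarrow> Poly_Mapping.single q' (Poly_Mapping.lookup f w * Poly_Mapping.lookup x q))"
proof -
  have "(\<Sum>q \<in> Poly_Mapping.keys x. case word_act E (letters w) q of
        None \<Rightarrow> 0
      | Some q' \<Rightarrow> Poly_Mapping.single q' (Poly_Mapping.lookup f w * Poly_Mapping.lookup x q))
     = (\<Sum>q \<in> Q. case word_act E (letters w) q of
        None \<Rightarrow> 0
      | Some q' \<Rightarrow> Poly_Mapping.single q' (Poly_Mapping.lookup f w * Poly_Mapping.lookup x q))" for w
    by (rule sum.mono_neutral_left) (use assms in \<open>auto simp: in_keys_iff split: option.splits\<close>)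
  then show ?thesis
    unfolding free_act_def
    by (simp, intro sum.mono_neutral_left)
      (use assms in \<open>auto simp: in_keys_iff split: option.splits intro!: sum.neutral\<close>)
qed

lemma free_act_add_left: "free_act E (f + g) x = free_act E f x + free_act E g x"
proof -
  let ?W = "Poly_Mapping.keys f \<union> Poly_Mapping.keys g" and ?Q = "Poly_Mapping.keys x"
  have "free_act E h x = (\<Sum>w \<in> ?W. \<Sum>q \<in> ?Q. case word_act E (letters w) q of
        None \<Rightarrow> 0
      | Some q' \<Rightarrow> Poly_Mapping.single q' (Poly_Mapping.lookup h w * Poly_Mapping.lookup x q))"
    if "h \<in> {f, g, f + g}" for h
    by (rule free_act_superset) (use that keys_add[of f g] in auto)
  then show ?thesis
    by (simp add: sum.distrib[symmetric])
      (intro sum.cong refl, auto simp: lookup_add single_add distrib_right split: option.splits)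
qed

lemma free_act_add_right: "free_act E f (x + y) = free_act E f x + free_act E f y"
proof -
  let ?W = "Poly_Mapping.keys f" and ?Q = "Poly_Mapping.keys x \<union> Poly_Mapping.keys y"
  have "free_act E f z = (\<Sum>w \<in> ?W. \<Sum>q \<in> ?Q. case word_act E (letters w) q of
        None \<Rightarrow> 0
      | Some q' \<Rightarrow> Poly_Mapping.single q' (Poly_Mapping.lookup f w * Poly_Mapping.lookup z q))"
    if "z \<in> {x, y, x + y}" for z
    by (rule free_act_superset) (use that keys_add[of x y] in auto)
  then show ?thesis
    by (simp add: sum.distrib[symmetric])
      (intro sum.cong refl, auto simp: lookup_add single_add distrib_left split: option.splits)
qed

lemma free_act_zero [simp]: "free_act E 0 x = 0" "free_act E f 0 = 0"
  by (simp_all add: free_act_def)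

lemma free_act_sum_left: "free_act E (sum h A) x = (\<Sum>i\<in>A. free_act E (h i) x)"
  by (induction A rule: infinite_finite_induct) (simp_all add: free_act_add_left)

lemma free_act_sum_right: "free_act E f (sum h A) = (\<Sum>i\<in>A. free_act E f (h i))"
  by (induction A rule: infinite_finite_induct) (simp_all add: free_act_add_right)

lemma free_act_uminus_left: "free_act E (- f) x = - free_act E f x"
  using free_act_add_left[of E f "- f" x] by (simp add: eq_neg_iff_add_eq_0 add.commute)

lemma free_act_diff_left: "free_act E (f - g) x = free_act E f x - free_act E g x"
  using free_act_add_left[of E f "- g" x] by (simp add: free_act_uminus_left)

lemma free_act_single:
  "free_act E (Poly_Mapping.single w a) (Poly_Mapping.single q b) =
    (case word_act E (letters w) q of None \<Rightarrow> 0 | Some q' \<Rightarrow> Poly_Mapping.single q' (a * b))"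
  by (subst free_act_superset[where W = "{w}" and Q = "{q}"]) (auto split: option.split)

lemma word_act_append:
  "word_act E (us @ ws) q = Option.bind (word_act E ws q) (word_act E us)"
  by (induction us) (auto split: Option.bind_splits)

lemma free_act_mult: "free_act E (f * g) x = free_act E f (free_act E g x)"
proof -
  have mono: "free_act E (Poly_Mapping.single u a * Poly_Mapping.single w b) (Poly_Mapping.single q c) =
      free_act E (Poly_Mapping.single u a) (free_act E (Poly_Mapping.single w b) (Poly_Mapping.single q c))"
    for u w a b q c
    by (auto simp: mult_single free_act_single word_act_append mult.assoc split: option.splits Option.bind_splits)
  let ?t = "\<lambda>h w. Poly_Mapping.single w (Poly_Mapping.lookup h w)"
  have "free_act E ((\<Sum>u \<in> Poly_Mapping.keys f. ?t f u) * (\<Sum>w \<in> Poly_Mapping.keys g. ?t g w))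
        (\<Sum>q \<in> Poly_Mapping.keys x. ?t x q)
    = free_act E (\<Sum>u \<in> Poly_Mapping.keys f. ?t f u)
       (free_act E (\<Sum>w \<in> Poly_Mapping.keys g. ?t g w) (\<Sum>q \<in> Poly_Mapping.keys x. ?t x q))"
    by (simp only: sum_distrib_left sum_distrib_right free_act_sum_left free_act_sum_right mono)
  then show ?thesis by (simp only: poly_mapping_expand)
qed

lemma tail_class_SCons:
  assumes "q \<in> tail_class E p" "e \<in> arcs E" "head E e = tail E (shd q)"
  shows "e ## q \<in> tail_class E p"
proof -
  obtain m n where "m > 0" "n > 0" "sdrop m p = sdrop n q"
    using assms(1) by (auto simp: tail_class_def tail_equivalent_def)
  then have "tail_equivalent p (e ## q)"
    unfolding tail_equivalent_def by (intro exI[of _ m] conjI exI[of _ "Suc n"]) auto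
  moreover have "e ## q \<in> infinite_paths E"
    unfolding infinite_paths_def
  proof (intro CollectI allI)
    fix i show "(e ## q) !! i \<in> arcs E \<and> head E ((e ## q) !! i) = tail E ((e ## q) !! Suc i)"
      using assms by (cases i) (auto simp: tail_class_def infinite_paths_def)
  qed
  ultimately show ?thesis by (simp add: tail_class_def)
qed

lemma tail_class_stl:
  assumes "q \<in> tail_class E p"
  shows "stl q \<in> tail_class E p"
proof -
  obtain m n where mn: "m > 0" "n > 0" "sdrop m p = sdrop n q"
    using assms by (auto simp: tail_class_def tail_equivalent_def)
  then have "sdrop (Suc m) p = sdrop n (stl q)"
    by (metis sdrop_simps(2) sdrop_stl)
  with mn have "tail_equivalent p (stl q)"
    unfolding tail_equivalent_def by (intro exI[of _ "Suc m"] conjI exI[of _ n]) auto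
  moreover have "stl q \<in> infinite_paths E"
    using assms by (auto simp: tail_class_def infinite_paths_def simp flip: snth.simps(2))
  ultimately show ?thesis by (simp add: tail_class_def)
qed

lemma gen_act_tail_class:
  "\<lbrakk>q \<in> tail_class E p; x \<in> lpa_gens E; gen_act E x q = Some q'\<rbrakk> \<Longrightarrow> q' \<in> tail_class E p"
  by (cases x) (auto split: if_splits intro: tail_class_SCons tail_class_stl)

lemma word_act_tail_class:
  "\<lbrakk>q \<in> tail_class E p; set xs \<subseteq> lpa_gens E; word_act E xs q = Some q'\<rbrakk> \<Longrightarrow> q' \<in> tail_class E p"
  by (induction xs arbitrary: q') (auto split: Option.bind_splits intro: gen_act_tail_class)

lemma carrier_path_module: "x \<in> carrier (path_module E p) \<longleftrightarrow> Poly_Mapping.keys x \<subseteq> tail_class E p"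
  by (simp add: path_module_def)

lemma path_module_simps [simp]:
  "zero (path_module E p) = 0" "add (path_module E p) = (+)"
  by (simp_all add: path_module_def)

lemma path_module_closed:
  "0 \<in> carrier (path_module E p)"
  "\<lbrakk>x \<in> carrier (path_module E p); y \<in> carrier (path_module E p)\<rbrakk> \<Longrightarrow> x + y \<in> carrier (path_module E p)"
  "x \<in> carrier (path_module E p) \<Longrightarrow> - x \<in> carrier (path_module E p)"
  using keys_add[of x y] by (auto simp: carrier_path_module keys_uminus')

lemma path_module_sum:
  "(\<And>i. i \<in> A \<Longrightarrow> h i \<in> carrier (path_module E p)) \<Longrightarrow> sum h A \<in> carrier (path_module E p)"
  by (induction A rule: infinite_finite_induct) (simp_all add: path_module_closed)

lemma free_act_closed:
  assumes "f \<in> carrier (free_algebra (lpa_gens E))" "x \<in> carrier (path_module E p)"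
  shows "free_act E f x \<in> carrier (path_module E p)"
  unfolding free_act_def
  by (intro path_module_sum)
    (use assms word_act_tail_class[of _ E p] in
      \<open>fastforce simp: carrier_path_module free_algebra_carrier split: option.splits\<close>)

lemma free_act_gen:
  "free_act E (gen x) (Poly_Mapping.single q b) =
    (case gen_act E x q of None \<Rightarrow> 0 | Some q' \<Rightarrow> Poly_Mapping.single q' b)"
  by (simp add: gen_def free_act_single split: option.split)

lemma shd_tail_class:
  assumes "q \<in> tail_class E p"
  shows "shd q \<in> arcs E" "head E (shd q) = tail E (shd (stl q))"
proof -
  have "\<forall>i. q !! i \<in> arcs E \<and> head E (q !! i) = tail E (q !! Suc i)"
    using assms by (simp add: tail_class_def infinite_paths_def)
  from spec[OF this, of 0] show "shd q \<in> arcs E" "head E (shd q) = tail E (shd (stl q))" by auto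
qed

lemma relation_kills_path:
  assumes "q \<in> tail_class E p" "r \<in> lpa_relations E"
  shows "free_act E r (Poly_Mapping.single q b) = 0"
proof -
  have ck: "free_act E (\<Sum>e \<in> out_arcs E v. gen (Edge e) * gen (Ghost e)) (Poly_Mapping.single q b)
      = free_act E (gen (Vertex v)) (Poly_Mapping.single q b)" if "finite (out_arcs E v)" for v
  proof -
    have "free_act E (\<Sum>e \<in> out_arcs E v. gen (Edge e) * gen (Ghost e)) (Poly_Mapping.single q b)
      = (\<Sum>e \<in> out_arcs E v. if e = shd q then Poly_Mapping.single q b else 0)"
      unfolding free_act_sum_left
      by (rule sum.cong) (use shd_tail_class[OF assms(1)] in \<open>auto simp: free_act_mult free_act_gen\<close>)
    also have "\<dots> = free_act E (gen (Vertex v)) (Poly_Mapping.single q b)"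
      using that shd_tail_class[OF assms(1)]
      by (auto simp: sum.delta free_act_gen out_arcs_def)
    finally show ?thesis .
  qed
  show ?thesis
    using assms(2) shd_tail_class[OF assms(1)] unfolding lpa_relations_def
    by (auto simp: free_act_diff_left free_act_mult free_act_gen ck regular_vertex_def split: if_splits)
qed

lemma lpa_ideal_kills:
  assumes "wf_digraph E" "r \<in> lpa_ideal E" "x \<in> carrier (path_module E p)"
  shows "free_act E r x = 0"
proof -
  let ?F = "free_algebra (lpa_gens E) :: ('a, 'b, 'c::field) lpa_free ring"
  let ?K = "{f \<in> carrier ?F. \<forall>x \<in> carrier (path_module E p). free_act E f x = 0}"
  interpret F: ring ?F by (rule ring_free_algebra)
  have "ideal ?K ?F"
  proof (rule idealI)
    show "subgroup ?K (add_monoid ?F)"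
    proof (rule F.add.subgroupI)
      fix f assume f: "f \<in> ?K"
      have "\<ominus>\<^bsub>?F\<^esub> f = - f"
        by (rule F.minus_equality) (use f in \<open>auto intro: free_algebra_uminus\<close>)
      with f show "\<ominus>\<^bsub>?F\<^esub> f \<in> ?K" by (auto simp: free_algebra_uminus free_act_uminus_left)
    next
      have "0 \<in> ?K" by (simp add: free_algebra_carrier)
      then show "?K \<noteq> {}" by blast
    qed (auto simp: free_algebra_add free_act_add_left)
  qed (auto simp: ring_free_algebra free_algebra_mult free_act_mult free_act_closed)
  moreover have "lpa_relations E \<subseteq> ?K"
  proof
    fix r :: "('a, 'b, 'c) lpa_free" assume r: "r \<in> lpa_relations E"
    have "free_act E r x = 0" if "x \<in> carrier (path_module E p)" for x
    proof -
      have "free_act E r (\<Sum>q \<in> Poly_Mapping.keys x. Poly_Mapping.single q (Poly_Mapping.lookup x q)) = 0"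
        unfolding free_act_sum_right
        by (rule sum.neutral)
          (use that r relation_kills_path[of _ E p] in \<open>auto simp: carrier_path_module\<close>)
      then show ?thesis by (simp only: poly_mapping_expand)
    qed
    with r show "r \<in> ?K" using lpa_relations_subset[OF assms(1)] by blast
  qed
  ultimately have "lpa_ideal E \<subseteq> ?K" by (rule F.genideal_minimal)
  with assms show ?thesis by blast
qed

lemma path_module_smult:
  assumes "wf_digraph E" "f \<in> carrier (free_algebra (lpa_gens E))" "x \<in> carrier (path_module E p)"
  shows "lpa_class E f \<odot>\<^bsub>path_module E p\<^esub> x = free_act E f x"
proof -
  have "(\<lambda>h. free_act E h x) ` lpa_class E f = {free_act E f x}"
    using lpa_ideal_kills[OF assms(1) _ assms(3)] lpa_ideal_closed(1)[OF assms(1)]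
    by (auto simp: a_r_coset_def' free_act_add_left image_iff)
  then show ?thesis by (simp add: path_module_def)
qed

lemma vertex_sum_act:
  assumes "fin_digraph E" "x \<in> carrier (path_module E p)"
  shows "free_act E (\<Sum>v \<in> verts E. gen (Vertex v)) x = x"
proof -
  interpret fin_digraph E by fact
  have "free_act E (\<Sum>v \<in> verts E. gen (Vertex v)) (Poly_Mapping.single q b) = Poly_Mapping.single q b"
    if "q \<in> tail_class E p" for q b
  proof -
    have "free_act E (\<Sum>v \<in> verts E. gen (Vertex v)) (Poly_Mapping.single q b)
       = (\<Sum>v \<in> verts E. if v = tail E (shd q) then Poly_Mapping.single q b else 0)"
      unfolding free_act_sum_left by (rule sum.cong) (auto simp: free_act_gen)
    then show ?thesis using shd_tail_class[OF that] by (simp add: sum.delta)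
  qed
  then have "free_act E (\<Sum>v \<in> verts E. gen (Vertex v))
      (\<Sum>q \<in> Poly_Mapping.keys x. Poly_Mapping.single q (Poly_Mapping.lookup x q))
     = (\<Sum>q \<in> Poly_Mapping.keys x. Poly_Mapping.single q (Poly_Mapping.lookup x q))"
    unfolding free_act_sum_right[of _ _ _ "Poly_Mapping.keys x"]
    by (intro sum.cong refl) (use assms(2) in \<open>auto simp: carrier_path_module\<close>)
  then show ?thesis by (simp only: poly_mapping_expand)
qed

theorem left_module_path_module:
  assumes "fin_digraph E"
  shows "left_module (leavitt_path_algebra E :: (('v, 'e, 'k::field) lpa_free set) ring) (path_module E p)"
    (is "left_module ?L ?M")
proof -
  interpret fin_digraph E by fact
  have smult: "lpa_class E f \<odot>\<^bsub>?M\<^esub> x = free_act E f x"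
    if "f \<in> augmentation E" "x \<in> carrier ?M" for f :: "('v, 'e, 'k) lpa_free" and x
    by (rule path_module_smult[OF wf_digraph_axioms augmentationD[OF that(1)] that(2)])
  note ops = carrier_lpa add_lpa[OF wf_digraph_axioms] mult_lpa[OF wf_digraph_axioms] one_lpa
    augmentation_closed vertex_sum_augmentation smult path_module_closed
    free_act_closed[OF augmentationD]
  show ?thesis
  proof (intro left_module.intro left_module_axioms.intro ring_leavitt_path_algebra assms)
    show "abelian_group ?M"
    proof (rule abelian_groupI)
      fix x assume "x \<in> carrier ?M"
      then show "\<exists>y\<in>carrier ?M. y \<oplus>\<^bsub>?M\<^esub> x = \<zero>\<^bsub>?M\<^esub>"
        by (intro bexI[of _ "- x"]) (simp_all add: path_module_closed)
    qed (simp_all add: path_module_closed add_ac)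
  qed (auto simp: ops free_act_add_left free_act_add_right free_act_mult vertex_sum_act[OF assms])
qed

lemma left_module_free_left_module:
  assumes "ring R"
  shows "left_module R (free_left_module R n)"
proof -
  interpret ring R by fact
  show ?thesis
  proof (intro left_module.intro left_module_axioms.intro assms)
    show "abelian_group (free_left_module R n)"
    proof (rule abelian_groupI)
      fix x assume "x \<in> carrier (free_left_module R n)"
      then show "\<exists>y\<in>carrier (free_left_module R n). y \<oplus>\<^bsub>free_left_module R n\<^esub> x = \<zero>\<^bsub>free_left_module R n\<^esub>"
        by (intro bexI[of _ "\<lambda>i\<in>{..<n}. \<ominus>\<^bsub>R\<^esub> x i"])
          (auto simp: free_left_module_def PiE_iff fun_eq_iff l_neg)
    qed (auto simp: free_left_module_def PiE_iff fun_eq_iff extensional_def a_ac)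
  qed (auto simp: free_left_module_def PiE_iff fun_eq_iff extensional_def l_distr r_distr m_assoc)
qed

end

theory Submission
  imports Defs "HOL-Library.Countable_Set"
begin

text \<open>
Let \<open>L\<close> be the Leavitt path algebra. The module is generated by each single path \<open>q\<close> of the
class, so it is \<open>L\<close> modulo the annihilator of \<open>q\<close>, and it is finitely presented if and only if
that annihilator is a finitely generated left ideal
(\<open>finitely_presented_annihilator\<close>, \<open>finitely_presented_cyclicI\<close>).

The annihilator is computed by comparing a path with its long initial segments. Modulo the
relations, a word times a sufficiently long initial segment of \<open>q\<close> is zero or an initial segment of
the path to which the word sends \<open>q\<close> (\<open>word_times_path\<close>). So an element that annihilates \<open>q\<close> also
annihilates a long initial segment of \<open>q\<close>, except that different words may lead to the same
infinite path by initial segments of different lengths (\<open>annihilator_times_path\<close>). This can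
happen only if \<open>q\<close> is eventually periodic.

If the class contains a purely periodic path \<open>ccc\<dots>\<close> with \<open>c\<close> of least length, the ambiguity consists
of powers of \<open>c\<close>, and the annihilator is generated by \<open>1 - c\<close> (\<open>periodic_annihilator\<close>).

If \<open>p\<close> is not eventually periodic, the annihilator of \<open>p\<close> is the union of the increasing sequence
of left ideals that annihilate the initial segments of \<open>p\<close>. If it were finitely generated, the
sequence would become constant. But it grows whenever the path passes a vertex \<open>v\<close> that emits an
edge besides the edge \<open>e\<close> of the path, because \<open>v - e e\<^sup>*\<close> is then non-zero in \<open>L\<close>
(\<open>branching_edge_not_full\<close>), and in a finite graph an aperiodic path passes such vertices infinitely often
(\<open>aperiodic_branches\<close>).
\<close>

section \<open>Eventually periodic streams\<close>

lemma stream_eqI: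
  assumes "\<And>i. x !! i = y !! i"
  shows "x = y"
  using assms
proof (coinduction arbitrary: x y)
  case Eq_stream
  then have "x !! 0 = y !! 0" "x !! Suc i = y !! Suc i" for i by blast+
  then show ?case by auto
qed

lemma sdrop_mult_period:
  assumes "sdrop d z = z"
  shows "sdrop (k * d) z = z"
  by (induction k) (simp_all add: assms flip: sdrop_add)

lemma periodic_eq_cycle:
  assumes "sdrop d z = z" "d > 0"
  shows "z = cycle (stake d z)"
proof -
  have "z !! i = cycle (stake d z) !! i" for i
  proof -
    have 1: "z !! i = z !! (i mod d)"
      using sdrop_mult_period[OF assms(1), of "i div d"]
      by (metis div_mult_mod_eq sdrop_snth)
    have "cycle (stake d z) !! i = cycle (stake d z) !! (i mod d)"
      using sdrop_mult_period[OF sdrop_cycle_eq, of "stake d z" "i div d"] assms(2)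
      by (metis div_mult_mod_eq length_stake list.size(3) not_less0 sdrop_snth)
    also have "\<dots> = (stake d z @- cycle (stake d z)) !! (i mod d)"
      using assms(2) by (subst cycle_decomp) auto
    also have "\<dots> = z !! (i mod d)"
      using assms(2) by (simp add: shift_snth_less stake_nth)
    finally show ?thesis using 1 by simp
  qed
  then show ?thesis by (rule stream_eqI)
qed

lemma least_period_dvd:
  assumes "sdrop d z = z" "\<And>b. 0 < b \<Longrightarrow> sdrop b z = z \<Longrightarrow> d \<le> b" "d > 0"
    and "sdrop b z = z"
  shows "d dvd b"
proof -
  have "sdrop (b mod d) z = z"
    using assms(4) sdrop_mult_period[OF assms(1), of "b div d"] by (metis div_mult_mod_eq sdrop_add)
  then show ?thesis
    using assms(2)[of "b mod d"] assms(3) by (meson dvd_eq_mod_eq_0 gr0I mod_less_divisor not_le)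
qed

lemma cas_path:
  assumes "p \<in> infinite_paths E"
  shows "pre_digraph.cas E (tail E (shd p)) (stake n p) (tail E (p !! n))"
  using assms
proof (induction n arbitrary: p)
  case 0
  then show ?case by (simp add: pre_digraph.cas.simps)
next
  case (Suc n)
  have inf: "stl p \<in> infinite_paths E"
    using Suc.prems by (auto simp: infinite_paths_def simp flip: snth.simps(2))
  have "head E (p !! 0) = tail E (p !! Suc 0)"
    using Suc.prems by (auto simp: infinite_paths_def simp del: snth.simps)
  with Suc.IH[OF inf] show ?case by (simp add: pre_digraph.cas.simps)
qed

lemma sdrop_infinite_paths: "p \<in> infinite_paths E \<Longrightarrow> sdrop n p \<in> infinite_paths E"
  by (auto simp: infinite_paths_def sdrop_snth)

text \<open>The right-hand side mentions neither closed paths nor tails of a second stream; it is the form in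
which periodicity is used below.\<close>

lemma tail_equivalent_cycle_iff:
  assumes "wf_digraph E" "p \<in> infinite_paths E"
  shows "(\<exists>c. wf_digraph.closed_w E c \<and> tail_equivalent p (cycle c))
    \<longleftrightarrow> (\<exists>i j. i < j \<and> sdrop i p = sdrop j p)"
proof -
  interpret wf_digraph E by fact
  show ?thesis
  proof
    assume "\<exists>c. closed_w c \<and> tail_equivalent p (Stream.cycle c)"
    then obtain c m n where c: "closed_w c" and mn: "sdrop m p = sdrop n (Stream.cycle c)"
      by (auto simp: tail_equivalent_def)
    have "sdrop (m + length c) p = sdrop (n + length c) (Stream.cycle c)"
      using mn by (metis sdrop_add)
    also have "\<dots> = sdrop n (Stream.cycle c)"
      using sdrop_cycle_eq[of c] c by (metis add.commute closed_w_def length_0_conv less_irrefl sdrop_add)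
    finally show "\<exists>i j. i < j \<and> sdrop i p = sdrop j p"
      using mn c by (intro exI[of _ m] exI[of _ "m + length c"]) (auto simp: closed_w_def)
  next
    assume "\<exists>i j. i < j \<and> sdrop i p = sdrop j p"
    then obtain i j where ij: "i < j" "sdrop i p = sdrop j p" by blast
    \<comment> \<open>tail equivalence asks for positive shifts, and \<open>i\<close> may be 0\<close>
    define z d where "z = sdrop (Suc i) p" and "d = j - i"
    have "sdrop (Suc i) p = sdrop (Suc j) p"
      using ij(2) by (metis sdrop_simps(2) sdrop_stl sdrop.simps(2))
    moreover have "Suc j = Suc i + d" and d: "d > 0" using ij(1) by (simp_all add: d_def)
    ultimately have per: "sdrop d z = z" by (metis sdrop_add z_def)
    have z: "z \<in> infinite_paths E" unfolding z_def by (rule sdrop_infinite_paths[OF assms(2)])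
    have "awalk (tail E (shd z)) (stake d z) (tail E (z !! d))"
      using cas_path[OF z] z unfolding awalk_def
      by (auto simp: infinite_paths_def in_set_conv_nth stake_nth simp flip: snth.simps(1) intro!: tail_in_verts)
    moreover have "z !! d = shd z" using per by (metis sdrop_simps(1))
    ultimately have "closed_w (stake d z)" using d by (auto simp: closed_w_def)
    moreover have "sdrop (Suc i) p = sdrop d (Stream.cycle (stake d z))"
      using periodic_eq_cycle[OF per d] per by (simp add: z_def)
    ultimately show "\<exists>c. closed_w c \<and> tail_equivalent p (Stream.cycle c)"
      using d unfolding tail_equivalent_def by blast
  qed
qed

text \<open>If from some point on every vertex of the path emits only the edge that the path takes, then the
path is determined by its current vertex. A vertex is repeated because there are only finitely
many, and the path is periodic from its first occurrence on.\<close>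

lemma aperiodic_branches:
  assumes "fin_digraph E" "p \<in> infinite_paths E" "\<not> (\<exists>i j. i < j \<and> sdrop i p = sdrop j p)"
  shows "\<exists>n\<ge>N. \<exists>e \<in> arcs E. tail E e = tail E (p !! n) \<and> e \<noteq> p !! n"
proof (rule ccontr)
  assume no: "\<not> ?thesis"
  interpret fin_digraph E by fact
  have step: "p !! Suc i \<in> arcs E" "tail E (p !! Suc i) = head E (p !! i)" "p !! i \<in> arcs E" for i
    using assms(2) by (auto simp: infinite_paths_def simp del: snth.simps)
  have "finite ((\<lambda>i. tail E (p !! i)) ` {N..})"
    by (rule finite_subset[OF _ finite_verts]) (use step in auto)
  then have "\<not> inj_on (\<lambda>i. tail E (p !! i)) {N..}"
    using finite_imageD infinite_Ici by blast
  then obtain i j where ij: "i \<ge> N" "j \<ge> N" "i < j" "tail E (p !! i) = tail E (p !! j)"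
    unfolding inj_on_def by (metis atLeast_iff linorder_neqE_nat)
  have "p !! (i + k) = p !! (j + k) \<and> tail E (p !! (i + k)) = tail E (p !! (j + k))" for k
  proof (induction k)
    case 0
    then show ?case using no ij step(3) by auto
  next
    case (Suc k)
    then have "tail E (p !! (i + Suc k)) = tail E (p !! (j + Suc k))" by (simp add: step del: snth.simps)
    moreover have "i + Suc k \<ge> N" using ij(1) by simp
    ultimately show ?case using no step(3)[of "j + Suc k"] by metis
  qed
  then have "sdrop i p !! k = sdrop j p !! k" for k by (simp add: sdrop_snth)
  then have "sdrop i p = sdrop j p" by (rule stream_eqI)
  with ij(3) assms(3) show False by blast
qed


section \<open>Words modulo the relations\<close>

text \<open>The relations are used as memberships in the ideal: the congruence of \<open>f\<close> and \<open>g\<close> is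
written as \<open>f - g \<in> lpa_ideal E\<close>.\<close>

abbreviation word :: "('v, 'e) lpa_gen list \<Rightarrow> ('v, 'e, 'k::field) lpa_free"
  where "word ws \<equiv> Poly_Mapping.single (Wd ws) 1"

abbreviation path :: "'e list \<Rightarrow> ('v, 'e, 'k::field) lpa_free"
  where "path es \<equiv> word (map Edge es)"

lemma word_append: "word (us @ ws) = word us * word ws"
  by (simp add: mult_single plus_free_monoid_def)

lemma word_Cons: "word (x # ws) = gen x * word ws"
  by (simp add: gen_def mult_single plus_free_monoid_def)

lemma word_Nil: "word [] = 1"
  by (simp flip: zero_free_monoid_def)

lemma word_in_free_algebra: "set ws \<subseteq> lpa_gens E \<Longrightarrow> word ws \<in> carrier (free_algebra (lpa_gens E))"
  by (simp add: free_algebra_carrier)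

lemma path_in_free_algebra: "set es \<subseteq> arcs E \<Longrightarrow> path es \<in> carrier (free_algebra (lpa_gens E))"
  by (rule word_in_free_algebra) auto

lemma word_augmentation: "ws \<noteq> [] \<Longrightarrow> set ws \<subseteq> lpa_gens E \<Longrightarrow> word ws \<in> augmentation E"
  by (simp add: augmentation_def word_in_free_algebra) (simp add: lookup_single zero_free_monoid_def)

lemma scalar_in_free_algebra: "Poly_Mapping.single 0 a \<in> carrier (free_algebra X)"
  by (simp add: free_algebra_carrier)

text \<open>One notion serves two rings: the Leavitt path algebra, where annihilators live, and the free
algebra, where computations modulo the relations take place.\<close>

definition left_ideal :: "('a, 'm) ring_scheme \<Rightarrow> 'a set \<Rightarrow> bool"
  where "left_ideal R J \<longleftrightarrow> J \<subseteq> carrier R \<and> \<zero>\<^bsub>R\<^esub> \<in> J \<and> (\<forall>x\<in>J. \<forall>y\<in>J. x \<oplus>\<^bsub>R\<^esub> y \<in> J)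
    \<and> (\<forall>a\<in>carrier R. \<forall>x\<in>J. a \<otimes>\<^bsub>R\<^esub> x \<in> J)"

lemma left_ideal_free:
  assumes "left_ideal (free_algebra X) J"
  shows "0 \<in> J" "f \<in> J \<Longrightarrow> g \<in> J \<Longrightarrow> f + g \<in> J" "f \<in> J \<Longrightarrow> g \<in> J \<Longrightarrow> f - g \<in> J"
    "a \<in> carrier (free_algebra X) \<Longrightarrow> f \<in> J \<Longrightarrow> a * f \<in> J" "J \<subseteq> carrier (free_algebra X)"
proof -
  show *: "a * f \<in> J" if "a \<in> carrier (free_algebra X)" "f \<in> J" for a f
    using that assms by (simp add: left_ideal_def)
  show add: "f + g \<in> J" if "f \<in> J" "g \<in> J" for f g
    using that assms by (simp add: left_ideal_def)
  show "f - g \<in> J" if "f \<in> J" "g \<in> J"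
    using add[OF that(1) *[of "- 1", OF _ that(2)]] by (simp add: free_algebra_carrier keys_uminus')
qed (use assms in \<open>auto simp: left_ideal_def\<close>)

lemma left_ideal_sum:
  "left_ideal (free_algebra X) J \<Longrightarrow> (\<And>i. i \<in> A \<Longrightarrow> h i \<in> J) \<Longrightarrow> sum h A \<in> J"
  by (induction A rule: infinite_finite_induct) (simp_all add: left_ideal_free)

lemma left_ideal_lpa_ideal:
  assumes "wf_digraph E"
  shows "left_ideal (free_algebra (lpa_gens E)) (lpa_ideal E)"
proof -
  interpret ideal "lpa_ideal E" "free_algebra (lpa_gens E)" by (rule ideal_lpa_ideal[OF assms])
  show ?thesis
    using lpa_ideal_closed[OF assms] a_subset by (auto simp: left_ideal_def)
qed

lemma gen_times_edge:
  assumes "wf_digraph E" "e \<in> arcs E"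
  shows "v \<in> verts E \<Longrightarrow> gen (Vertex v) * gen (Edge e) - (if v = tail E e then gen (Edge e) else 0) \<in> lpa_ideal E"
    and "f \<in> arcs E \<Longrightarrow> head E f \<noteq> tail E e \<Longrightarrow> gen (Edge f) * gen (Edge e) \<in> lpa_ideal E"
    and "f \<in> arcs E \<Longrightarrow> gen (Ghost f) * gen (Edge e) - (if f = e then gen (Vertex (head E e)) else 0) \<in> lpa_ideal E"
proof -
  interpret wf_digraph E by fact
  note cl = left_ideal_free[OF left_ideal_lpa_ideal[OF assms(1)]]
  note clr = lpa_ideal_closed(3)[OF assms(1)]
  have rel: "r \<in> lpa_relations E \<Longrightarrow> r \<in> lpa_ideal E" for r
    by (rule lpa_relations_in_ideal[OF assms(1)])
  let ?s = "gen (Vertex (tail E e))" and ?e = "gen (Edge e)"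
  have se: "?s * ?e - ?e \<in> lpa_ideal E"
    by (rule rel) (use assms in \<open>auto simp: lpa_relations_def\<close>)
  show "gen (Vertex v) * ?e - (if v = tail E e then ?e else 0) \<in> lpa_ideal E" if v: "v \<in> verts E"
  proof (cases "v = tail E e")
    case False
    have vs: "gen (Vertex v) * ?s \<in> lpa_ideal E"
      by (rule rel) (use False v assms in \<open>auto simp: lpa_relations_def\<close>)
    have "gen (Vertex v) * ?e = gen (Vertex v) * ?s * ?e - gen (Vertex v) * (?s * ?e - ?e)"
      by (simp add: algebra_simps)
    also have "\<dots> \<in> lpa_ideal E"
      by (intro cl(3) clr[OF vs] cl(4)[OF _ se]) (use assms v in auto)
    finally show ?thesis using False by simp
  qed (use se in simp)
  show "gen (Edge f) * ?e \<in> lpa_ideal E" if f: "f \<in> arcs E" "head E f \<noteq> tail E e"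
  proof -
    let ?f = "gen (Edge f)" and ?r = "gen (Vertex (head E f))"
    have fr: "?f * ?r - ?f \<in> lpa_ideal E"
      by (rule rel) (use f in \<open>auto simp: lpa_relations_def\<close>)
    have rs: "?r * ?s \<in> lpa_ideal E"
      by (rule rel) (use f assms in \<open>auto simp: lpa_relations_def\<close>)
    have "?f * ?e = ?f * (?r * ?s * ?e - ?r * (?s * ?e - ?e)) - (?f * ?r - ?f) * ?e"
      by (simp add: algebra_simps)
    also have "\<dots> \<in> lpa_ideal E"
      by (intro cl(3) clr[OF rs] clr[OF fr] cl(4)[OF _ se] cl(4)[of "?f"]) (use assms f in auto)
    finally show ?thesis .
  qed
  show "gen (Ghost f) * ?e - (if f = e then gen (Vertex (head E e)) else 0) \<in> lpa_ideal E" if "f \<in> arcs E"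
    by (rule rel) (use assms that in \<open>auto simp: lpa_relations_def\<close>)
qed

lemma infinite_pathsD:
  assumes "q \<in> infinite_paths E"
  shows "shd q \<in> arcs E" "stl q \<in> infinite_paths E" "head E (shd q) = tail E (shd (stl q))"
    "set (stake n q) \<subseteq> arcs E"
proof -
  have q: "q !! i \<in> arcs E" "head E (q !! i) = tail E (q !! Suc i)" for i
    using assms by (auto simp: infinite_paths_def simp del: snth.simps)
  show "shd q \<in> arcs E" "head E (shd q) = tail E (shd (stl q))" using q[of 0] by auto
  show "stl q \<in> infinite_paths E"
    using assms by (auto simp: infinite_paths_def simp flip: snth.simps(2))
  show "set (stake n q) \<subseteq> arcs E"
    using q(1) by (auto simp: in_set_conv_nth stake_nth)
qed

lemma gen_act_infinite_paths:
  assumes "q \<in> infinite_paths E" "x \<in> lpa_gens E" "gen_act E x q = Some q'"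
  shows "q' \<in> infinite_paths E"
proof -
  have "q \<in> tail_class E q" using assms(1) by (auto simp: tail_class_def tail_equivalent_def)
  from gen_act_tail_class[OF this assms(2,3)] show ?thesis by (simp add: tail_class_def)
qed

lemma vertex_times_path:
  fixes E :: "('v, 'e) pre_digraph"
  assumes "wf_digraph E" "q \<in> infinite_paths E" "n > 0"
  shows "gen (Vertex (tail E (shd q))) * path (stake n q) - path (stake n q)
    \<in> (lpa_ideal E :: ('v, 'e, 'k::field) lpa_free set)"
proof -
  interpret wf_digraph E by fact
  note q = infinite_pathsD[OF assms(2)]
  obtain m where m: "n = Suc m" using assms(3) gr0_conv_Suc by blast
  have "path (stake m (stl q)) \<in> carrier (free_algebra (lpa_gens E) :: ('v, 'e, 'k) lpa_free ring)"
    by (rule path_in_free_algebra[OF infinite_pathsD(4)[OF q(2)]])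
  from lpa_ideal_closed(3)[OF assms(1) gen_times_edge(1)[OF assms(1) q(1) tail_in_verts[OF q(1)]] this]
  show ?thesis by (simp add: m word_Cons algebra_simps)
qed

text \<open>Multiplying a finite initial segment of \<open>q\<close> by a generator imitates the action on \<open>q\<close> itself:
the result is an initial segment of the new path, with the same continuation. At least two edges
are needed, since a ghost edge may cancel one of them and the vertex that it leaves behind
must be absorbed by the next edge.\<close>

lemma gen_times_path:
  fixes E :: "('v, 'e) pre_digraph"
  assumes "wf_digraph E" "q \<in> infinite_paths E" "x \<in> lpa_gens E" "j \<ge> 2"
  shows "case gen_act E x q of
      None \<Rightarrow> gen x * path (stake j q) \<in> (lpa_ideal E :: ('v, 'e, 'k::field) lpa_free set)
    | Some q' \<Rightarrow> \<exists>j'. j \<le> Suc j' \<and> sdrop j' q' = sdrop j q \<and>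
        gen x * path (stake j q) - path (stake j' q') \<in> (lpa_ideal E :: ('v, 'e, 'k::field) lpa_free set)"
proof -
  interpret wf_digraph E by fact
  note cl = left_ideal_free[OF left_ideal_lpa_ideal[OF assms(1)]]
  note q = infinite_pathsD[OF assms(2)]
  note q2 = infinite_pathsD[OF q(2)]
  obtain i where i: "j = Suc (Suc i)" using assms(4) by (metis add_2_eq_Suc le_Suc_ex)
  let ?e = "shd q" and ?b = "path (stake (Suc i) (stl q))"
  have b: "?b \<in> carrier (free_algebra (lpa_gens E))" by (rule path_in_free_algebra[OF q2(4)])
  have split: "path (stake j q) = gen (Edge ?e) * ?b" by (simp add: i word_Cons)
  note times_edge = gen_times_edge[OF assms(1) q(1)]
  show ?thesis
  proof (cases x)
    case (Vertex v)
    then have "v \<in> verts E" using assms(3) by simp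
    from lpa_ideal_closed(3)[OF assms(1) times_edge(1)[OF this] b] show ?thesis
      unfolding Vertex split by (auto simp: algebra_simps split intro!: exI[of _ j])
  next
    case (Edge f)
    then have f: "f \<in> arcs E" using assms(3) by simp
    show ?thesis
    proof (cases "head E f = tail E ?e")
      case True
      then show ?thesis using cl(1)
        by (auto simp: Edge word_Cons[symmetric] intro!: exI[of _ "Suc j"])
    next
      case False
      from lpa_ideal_closed(3)[OF assms(1) times_edge(2)[OF f this] b] False show ?thesis
        unfolding Edge split by (auto simp: mult.assoc)
    qed
  next
    case (Ghost f)
    then have f: "f \<in> arcs E" using assms(3) by simp
    note ge = lpa_ideal_closed(3)[OF assms(1) times_edge(3)[OF f] b]
    show ?thesis
    proof (cases "f = ?e")
      case True
      have "gen (Vertex (head E ?e)) * ?b - ?b \<in> (lpa_ideal E :: ('v, 'e, 'k) lpa_free set)"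
        using vertex_times_path[OF assms(1) q(2), of "Suc i"] q(3) by simp
      from cl(2)[OF this ge] True have "gen (Ghost f) * path (stake j q) - ?b \<in> (lpa_ideal E :: ('v, 'e, 'k) lpa_free set)"
        unfolding split by (simp add: algebra_simps)
      then show ?thesis using True i by (auto simp: Ghost intro!: exI[of _ "Suc i"])
    next
      case False
      then show ?thesis using ge unfolding Ghost split by (auto simp: algebra_simps)
    qed
  qed
qed

text \<open>Each letter costs at most one edge, which explains the bound on \<open>j\<close>.\<close>

lemma word_times_path:
  fixes E :: "('v, 'e) pre_digraph"
  assumes "wf_digraph E" "q \<in> infinite_paths E" "set ws \<subseteq> lpa_gens E" "j \<ge> length ws + 2"
  shows "case word_act E ws q of
      None \<Rightarrow> word ws * path (stake j q) \<in> (lpa_ideal E :: ('v, 'e, 'k::field) lpa_free set)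
    | Some q' \<Rightarrow> \<exists>j'. j \<le> j' + length ws \<and> q' \<in> infinite_paths E \<and> sdrop j' q' = sdrop j q \<and>
        word ws * path (stake j q) - path (stake j' q') \<in> (lpa_ideal E :: ('v, 'e, 'k::field) lpa_free set)"
  using assms(3,4)
proof (induction ws)
  case Nil
  then show ?case
    using assms(2) left_ideal_free(1)[OF left_ideal_lpa_ideal[OF assms(1)]]
    by (auto simp: word_Nil intro!: exI[of _ j])
next
  case (Cons x ws)
  note cl = left_ideal_free[OF left_ideal_lpa_ideal[OF assms(1)]]
  have x: "x \<in> lpa_gens E" and gx: "gen x \<in> carrier (free_algebra (lpa_gens E))" using Cons.prems by auto
  show ?case
  proof (cases "word_act E ws q")
    case None
    then show ?thesis
      using cl(4)[OF gx] Cons by (auto simp: word_Cons mult.assoc)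
  next
    case (Some r)
    then obtain i where i: "j \<le> i + length ws" "r \<in> infinite_paths E" "sdrop i r = sdrop j q"
      "word ws * path (stake j q) - path (stake i r) \<in> (lpa_ideal E :: ('v, 'e, 'k) lpa_free set)"
      using Cons by auto
    then have "i \<ge> 2" using Cons.prems by simp
    note gp = gen_times_path[OF assms(1) i(2) x this]
    have d: "gen x * (word ws * path (stake j q) - path (stake i r)) \<in> (lpa_ideal E :: ('v, 'e, 'k) lpa_free set)"
      by (rule cl(4)[OF gx i(4)])
    show ?thesis
    proof (cases "gen_act E x r")
      case None
      then have "gen x * path (stake i r) \<in> (lpa_ideal E :: ('v, 'e, 'k) lpa_free set)" using gp by simp
      from cl(2)[OF this d] show ?thesis using None Some
        by (simp add: word_Cons algebra_simps)
    next
      case (Some q')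
      then obtain j' where j': "i \<le> Suc j'" "sdrop j' q' = sdrop i r"
        "gen x * path (stake i r) - path (stake j' q') \<in> (lpa_ideal E :: ('v, 'e, 'k) lpa_free set)"
        using gp by auto
      from cl(2)[OF this(3) d] have "word (x # ws) * path (stake j q) - path (stake j' q') \<in> (lpa_ideal E :: ('v, 'e, 'k) lpa_free set)"
        by (simp add: word_Cons algebra_simps)
      then show ?thesis using Some \<open>word_act E ws q = Some r\<close> i j' gen_act_infinite_paths[OF i(2) x]
        by (auto intro!: exI[of _ j'])
    qed
  qed
qed

text \<open>Scalars are constants of the free algebra, that is, multiples of the empty word.\<close>

definition lin_ext :: "('q \<Rightarrow> 'g free_monoid \<Rightarrow>\<^sub>0 'k::field) \<Rightarrow> ('q \<Rightarrow>\<^sub>0 'k) \<Rightarrow> 'g free_monoid \<Rightarrow>\<^sub>0 'k"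
  where "lin_ext t x = (\<Sum>q \<in> Poly_Mapping.keys x. Poly_Mapping.single 0 (Poly_Mapping.lookup x q) * t q)"

lemma lin_ext_superset:
  assumes "finite Q" "Poly_Mapping.keys x \<subseteq> Q"
  shows "lin_ext t x = (\<Sum>q \<in> Q. Poly_Mapping.single 0 (Poly_Mapping.lookup x q) * t q)"
  unfolding lin_ext_def by (rule sum.mono_neutral_left) (use assms in \<open>auto simp: in_keys_iff\<close>)

lemma lin_ext_add: "lin_ext t (x + y) = lin_ext t x + lin_ext t y"
proof -
  let ?Q = "Poly_Mapping.keys x \<union> Poly_Mapping.keys y"
  have "lin_ext t z = (\<Sum>q \<in> ?Q. Poly_Mapping.single 0 (Poly_Mapping.lookup z q) * t q)"
    if "z \<in> {x, y, x + y}" for z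
    by (rule lin_ext_superset) (use that keys_add[of x y] in auto)
  then show ?thesis by (simp add: sum.distrib[symmetric] lookup_add single_add distrib_right)
qed

lemma lin_ext_zero: "lin_ext t 0 = 0"
  by (simp add: lin_ext_def)

lemma lin_ext_single: "lin_ext t (Poly_Mapping.single q a) = Poly_Mapping.single 0 a * t q"
  by (subst lin_ext_superset[of "{q}"]) auto

lemma lin_ext_sum: "lin_ext t (sum h A) = (\<Sum>i\<in>A. lin_ext t (h i))"
  by (induction A rule: infinite_finite_induct) (simp_all add: lin_ext_add lin_ext_zero)

text \<open>The bridge between the module and the algebra. A relation between the paths \<open>w \<bullet> p\<close>, for the words
\<open>w\<close> of \<open>f\<close>, is lifted along a linear map that replaces a path by an initial segment of it; by
\<open>word_times_path\<close> this lift of \<open>f \<bullet> p\<close> is congruent modulo \<open>J\<close> to \<open>f\<close> times a long initial segment of \<open>p\<close>.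
The segment that represents a path must leave the same continuation as the chosen segment of \<open>p\<close>.
Only its length may be ambiguous, and \<open>J\<close> is any left ideal that contains the relations and
identifies the possible choices.\<close>

lemma annihilator_times_path:
  fixes E :: "('v, 'e) pre_digraph" and f :: "('v, 'e, 'k::field) lpa_free"
  assumes "wf_digraph E" "p \<in> infinite_paths E"
    and f: "f \<in> carrier (free_algebra (lpa_gens E))" "free_act E f (Poly_Mapping.single p 1) = 0"
    and J: "left_ideal (free_algebra (lpa_gens E)) J" "lpa_ideal E \<subseteq> J"
    and j: "\<And>w. w \<in> Poly_Mapping.keys f \<Longrightarrow> length (letters w) + 2 \<le> j"
    and t: "\<And>q a b. q \<in> infinite_paths E \<Longrightarrow> sdrop a q = sdrop j p \<Longrightarrow> sdrop b q = sdrop j p \<Longrightarrow>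
      path (stake a q) - path (stake b q) \<in> J"
  shows "f * path (stake j p) \<in> J"
proof -
  \<comment> \<open>every path \<open>w \<bullet> p\<close> has an initial segment of this kind; the default value is for the other paths\<close>
  define t :: "'e stream \<Rightarrow> ('v, 'e, 'k) lpa_free"
    where "t q = path (stake (SOME a. sdrop a q = sdrop j p) q)" for q
  define tw where "tw w = (case word_act E (letters w) p of None \<Rightarrow> 0 | Some q \<Rightarrow> t q)" for w
  note cl = left_ideal_free[OF J(1)]
  let ?c = "\<lambda>w. Poly_Mapping.single 0 (Poly_Mapping.lookup f w)"
  have w: "word (letters w) * path (stake j p) - tw w \<in> J" if "w \<in> Poly_Mapping.keys f" for w
  proof -
    have "set (letters w) \<subseteq> lpa_gens E" using f(1) that by (auto simp: free_algebra_carrier)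
    note wp = word_times_path[OF assms(1,2) this j[OF that], where 'k = 'k]
    show ?thesis
    proof (cases "word_act E (letters w) p")
      case None
      then show ?thesis using wp J(2) by (auto simp: tw_def)
    next
      case (Some q)
      then obtain i where i: "q \<in> infinite_paths E" "sdrop i q = sdrop j p"
        "word (letters w) * path (stake j p) - path (stake i q) \<in> (lpa_ideal E :: ('v, 'e, 'k) lpa_free set)"
        using wp by auto
      have "path (stake i q) - t q \<in> J"
        unfolding t_def by (intro assms(8) i) (rule someI[of _ i], rule i)
      from cl(2)[OF this] i(3) J(2) Some show ?thesis by (fastforce simp: tw_def)
    qed
  qed
  have "f * path (stake j p)
    = (\<Sum>w \<in> Poly_Mapping.keys f. Poly_Mapping.single w (Poly_Mapping.lookup f w)) * path (stake j p)"
    by (simp only: poly_mapping_expand)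
  also have "\<dots> = (\<Sum>w \<in> Poly_Mapping.keys f. ?c w * (word (letters w) * path (stake j p)))"
    by (simp add: sum_distrib_right mult_single flip: mult.assoc)
  also have "\<dots> = (\<Sum>w \<in> Poly_Mapping.keys f. ?c w * (word (letters w) * path (stake j p) - tw w))
      + (\<Sum>w \<in> Poly_Mapping.keys f. ?c w * tw w)"
    by (simp add: algebra_simps flip: sum.distrib)
  also have "(\<Sum>w \<in> Poly_Mapping.keys f. ?c w * tw w) = lin_ext t (free_act E f (Poly_Mapping.single p 1))"
  proof -
    have "free_act E f (Poly_Mapping.single p 1) = (\<Sum>w \<in> Poly_Mapping.keys f. 
      case word_act E (letters w) p of None \<Rightarrow> 0 | Some q \<Rightarrow> Poly_Mapping.single q (Poly_Mapping.lookup f w))"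
      by (subst free_act_superset[where W = "Poly_Mapping.keys f" and Q = "{p}"])
        (auto intro!: sum.cong split: option.split)
    then show ?thesis
      by (simp add: lin_ext_sum tw_def) 
        (intro sum.cong refl, auto simp: lin_ext_single lin_ext_zero split: option.split)
  qed
  finally have "f * path (stake j p) = (\<Sum>w \<in> Poly_Mapping.keys f. ?c w * (word (letters w) * path (stake j p) - tw w))"
    by (simp add: f(2) lin_ext_zero)
  then show ?thesis
    by (simp only:) (intro left_ideal_sum[OF J(1)] cl(4) w scalar_in_free_algebra)
qed


section \<open>Annihilators in finitely presented cyclic modules\<close>

definition unit_vector :: "('a, 'm) ring_scheme \<Rightarrow> nat \<Rightarrow> nat \<Rightarrow> nat \<Rightarrow> 'a"
  where "unit_vector R n i = (\<lambda>j\<in>{..<n}. if j = i then \<one>\<^bsub>R\<^esub> else \<zero>\<^bsub>R\<^esub>)"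

lemma free_left_module_simps:
  "w \<in> carrier (free_left_module R n) \<longleftrightarrow> w \<in> {..<n} \<rightarrow>\<^sub>E carrier R"
  "\<zero>\<^bsub>free_left_module R n\<^esub> = (\<lambda>i\<in>{..<n}. \<zero>\<^bsub>R\<^esub>)"
  "x \<oplus>\<^bsub>free_left_module R n\<^esub> y = (\<lambda>i\<in>{..<n}. x i \<oplus>\<^bsub>R\<^esub> y i)"
  "a \<odot>\<^bsub>free_left_module R n\<^esub> x = (\<lambda>i\<in>{..<n}. a \<otimes>\<^bsub>R\<^esub> x i)"
  by (simp_all add: free_left_module_def)

lemma unit_vector_closed: "ring R \<Longrightarrow> unit_vector R n i \<in> carrier (free_left_module R n)"
  by (auto simp: unit_vector_def free_left_module_simps ring.ring_simprules)

text \<open>As an induction rule, generation by the unit vectors serves both to show that two homomorphisms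
agree and to show that the image of a homomorphism lies in a left ideal.\<close>

lemma free_left_module_induct [consumes 2, case_names zero unit_vector add smult]:
  assumes "ring R" and w: "w \<in> carrier (free_left_module R n)"
    and zero: "P \<zero>\<^bsub>free_left_module R n\<^esub>"
    and unit: "\<And>i. i < n \<Longrightarrow> P (unit_vector R n i)"
    and add: "\<And>x y. x \<in> carrier (free_left_module R n) \<Longrightarrow> y \<in> carrier (free_left_module R n) \<Longrightarrow>
      P x \<Longrightarrow> P y \<Longrightarrow> P (x \<oplus>\<^bsub>free_left_module R n\<^esub> y)"
    and smult: "\<And>a x. a \<in> carrier R \<Longrightarrow> x \<in> carrier (free_left_module R n) \<Longrightarrow>
      P x \<Longrightarrow> P (a \<odot>\<^bsub>free_left_module R n\<^esub> x)"
  shows "P w"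
proof -
  interpret R: ring R by fact
  interpret F: left_module R "free_left_module R n"
    by (rule left_module_free_left_module[OF assms(1)])
  let ?w = "\<lambda>k. \<lambda>j\<in>{..<n}. if j < k then w j else \<zero>\<^bsub>R\<^esub>"
  have wj: "w j \<in> carrier R" if "j < n" for j using w that by (auto simp: free_left_module_simps)
  have cl: "?w k \<in> carrier (free_left_module R n)" for k
    using wj by (auto simp: free_left_module_simps)
  have "P (?w k)" if "k \<le> n" for k
    using that
  proof (induction k)
    case 0
    then show ?case using zero by (simp add: free_left_module_simps restrict_def)
  next
    case (Suc k)
    have "?w (Suc k) = ?w k \<oplus>\<^bsub>free_left_module R n\<^esub> w k \<odot>\<^bsub>free_left_module R n\<^esub> unit_vector R n k"
      using wj[of k] Suc.prems
      by (intro ext) (auto simp: free_left_module_simps unit_vector_def less_Suc_eq wj)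
    moreover have "P (?w k)" by (rule Suc.IH) (use Suc.prems in simp)
    ultimately show ?case
      using Suc.prems
      by (simp only:) (intro add smult unit cl F.smult_closed unit_vector_closed wj assms(1); simp)
  qed
  from this[of n] have "P (?w n)" by simp
  moreover have "?w n = w" using w by (auto simp: free_left_module_simps PiE_def extensional_def)
  ultimately show ?thesis by simp
qed

lemma (in left_module) smult_zero:
  assumes "x \<in> carrier M"
  shows "\<zero> \<odot>\<^bsub>M\<^esub> x = \<zero>\<^bsub>M\<^esub>"
proof -
  have "\<zero> \<odot>\<^bsub>M\<^esub> x \<oplus>\<^bsub>M\<^esub> \<zero> \<odot>\<^bsub>M\<^esub> x = \<zero> \<odot>\<^bsub>M\<^esub> x"
    using smult_l_distr[of \<zero> \<zero> x] assms by simp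
  then show ?thesis using assms by (simp add: M.add.l_cancel_one)
qed

lemma left_module_hom_zero:
  assumes "left_module R M" "left_module R N" "h \<in> left_module_hom R M N"
  shows "h \<zero>\<^bsub>M\<^esub> = \<zero>\<^bsub>N\<^esub>"
proof -
  interpret M: left_module R M by fact
  interpret N: left_module R N by fact
  have "h (\<zero>\<^bsub>R\<^esub> \<odot>\<^bsub>M\<^esub> \<zero>\<^bsub>M\<^esub>) = \<zero>\<^bsub>R\<^esub> \<odot>\<^bsub>N\<^esub> h \<zero>\<^bsub>M\<^esub>" "h \<zero>\<^bsub>M\<^esub> \<in> carrier N"
    using assms(3) by (auto simp: left_module_hom_def)
  then show ?thesis by (simp add: M.smult_zero N.smult_zero)
qed

text \<open>The annihilator of a generator of a finitely presented module is a finitely generated left ideal,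
whatever the given presentation is. Generation is expressed by testing against all left ideals
that contain the finite set \<open>G\<close>. The proof lifts the presentation \<open>f\<close> to a map \<open>B\<close>
from the free module to the ring with \<open>B w\<close> acting on \<open>x\<close> as \<open>f w\<close>. If \<open>f y = x\<close> and \<open>a\<close>
annihilates \<open>x\<close>, then \<open>a y\<close> is a relation of the presentation, so
\<open>a = a (1 - B y) + B (a y)\<close> is a combination of \<open>1 - B y\<close> and the images
under \<open>B\<close> of the finitely many basic relations.\<close>

lemma finitely_presented_annihilator:
  fixes R (structure) and M (structure)
  assumes "left_module R M" "finitely_presented R M"
    and x: "x \<in> carrier M" and cyclic: "carrier M \<subseteq> (\<lambda>a. a \<odot>\<^bsub>M\<^esub> x) ` carrier R"
  shows "\<exists>G. finite G \<and> G \<subseteq> {a \<in> carrier R. a \<odot>\<^bsub>M\<^esub> x = \<zero>\<^bsub>M\<^esub>} \<and>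
    (\<forall>H. left_ideal R H \<longrightarrow> G \<subseteq> H \<longrightarrow> {a \<in> carrier R. a \<odot>\<^bsub>M\<^esub> x = \<zero>\<^bsub>M\<^esub>} \<subseteq> H)"
proof -
  interpret M: left_module R M by fact
  have R: "ring R" by (rule M.R.ring_axioms)
  obtain m n g f where g: "g \<in> left_module_hom R (free_left_module R m) (free_left_module R n)"
    and f: "f \<in> left_module_hom R (free_left_module R n) M"
    and surj: "f ` carrier (free_left_module R n) = carrier M"
    and exact: "g ` carrier (free_left_module R m) = {x \<in> carrier (free_left_module R n). f x = \<zero>\<^bsub>M\<^esub>}"
    using assms(2) unfolding finitely_presented_def by blast
  define Fn Fm where "Fn = free_left_module R n" and "Fm = free_left_module R m"
  interpret Fn: left_module R Fn unfolding Fn_def by (rule left_module_free_left_module[OF R])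
  interpret Fm: left_module R Fm unfolding Fm_def by (rule left_module_free_left_module[OF R])
  note folds = Fn_def[symmetric] Fm_def[symmetric]
  have f_cl: "f w \<in> carrier M" if "w \<in> carrier Fn" for w using f that by (auto simp: left_module_hom_def Fn_def)
  have g_cl: "g z \<in> carrier Fn" if "z \<in> carrier Fm" for z using g that by (auto simp: left_module_hom_def Fn_def Fm_def)
  have f_add: "f (v \<oplus>\<^bsub>Fn\<^esub> w) = f v \<oplus>\<^bsub>M\<^esub> f w" if "v \<in> carrier Fn" "w \<in> carrier Fn" for v w
    using f that by (auto simp: left_module_hom_def Fn_def)
  have f_smult: "f (a \<odot>\<^bsub>Fn\<^esub> w) = a \<odot>\<^bsub>M\<^esub> f w" if "a \<in> carrier R" "w \<in> carrier Fn" for a w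
    using f that by (auto simp: left_module_hom_def Fn_def)
  have g_add: "g (v \<oplus>\<^bsub>Fm\<^esub> w) = g v \<oplus>\<^bsub>Fn\<^esub> g w" if "v \<in> carrier Fm" "w \<in> carrier Fm" for v w
    using g that by (auto simp: left_module_hom_def Fn_def Fm_def)
  have g_smult: "g (a \<odot>\<^bsub>Fm\<^esub> w) = a \<odot>\<^bsub>Fn\<^esub> g w" if "a \<in> carrier R" "w \<in> carrier Fm" for a w
    using g that by (auto simp: left_module_hom_def Fn_def Fm_def)
  have f_zero: "f \<zero>\<^bsub>Fn\<^esub> = \<zero>\<^bsub>M\<^esub>"
    by (rule left_module_hom_zero[OF Fn.left_module_axioms assms(1)]) (use f in \<open>simp add: Fn_def\<close>)
  have g_zero: "g \<zero>\<^bsub>Fm\<^esub> = \<zero>\<^bsub>Fn\<^esub>"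
    by (rule left_module_hom_zero[OF Fm.left_module_axioms Fn.left_module_axioms]) (use g in \<open>simp add: Fn_def Fm_def\<close>)
  note uv = unit_vector_closed[OF R, of n, folded Fn_def] unit_vector_closed[OF R, of m, folded Fm_def]

  have "\<exists>b \<in> carrier R. b \<odot>\<^bsub>M\<^esub> x = f (unit_vector R n i)" for i
    using f_cl[OF uv(1)[of i]] cyclic by (metis (no_types, lifting) image_iff subsetD)
  then obtain b where b: "\<And>i. b i \<in> carrier R" "\<And>i. b i \<odot>\<^bsub>M\<^esub> x = f (unit_vector R n i)" by metis
  define B where "B w = (\<Oplus>i\<in>{..<n}. w i \<otimes> b i)" for w
  have Fn_at: "w i \<in> carrier R" if "w \<in> carrier Fn" "i < n" for w i
    using that by (auto simp: Fn_def free_left_module_simps)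
  have B_cl: "B w \<in> carrier R" if "w \<in> carrier Fn" for w
    unfolding B_def by (rule M.R.finsum_closed) (use that Fn_at b(1) in auto)
  have B_add: "B (v \<oplus>\<^bsub>Fn\<^esub> w) = B v \<oplus> B w" if "v \<in> carrier Fn" "w \<in> carrier Fn" for v w
  proof -
    have "B (v \<oplus>\<^bsub>Fn\<^esub> w) = (\<Oplus>i\<in>{..<n}. v i \<otimes> b i \<oplus> w i \<otimes> b i)"
      unfolding B_def
      by (rule M.R.finsum_cong') (use that Fn_at b(1) in \<open>auto simp: Fn_def free_left_module_simps M.R.l_distr\<close>)
    also have "\<dots> = B v \<oplus> B w"
      unfolding B_def by (rule M.R.finsum_addf) (use that Fn_at b(1) in auto)
    finally show ?thesis .
  qed
  have B_smult: "B (a \<odot>\<^bsub>Fn\<^esub> w) = a \<otimes> B w" if "a \<in> carrier R" "w \<in> carrier Fn" for a w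
  proof -
    have "B (a \<odot>\<^bsub>Fn\<^esub> w) = (\<Oplus>i\<in>{..<n}. a \<otimes> (w i \<otimes> b i))"
      unfolding B_def
      by (rule M.R.finsum_cong') (use that Fn_at b(1) in \<open>auto simp: Fn_def free_left_module_simps M.R.m_assoc\<close>)
    also have "\<dots> = a \<otimes> B w"
      unfolding B_def by (rule M.R.finsum_rdistr[symmetric]) (use that Fn_at b(1) in auto)
    finally show ?thesis .
  qed
  have B_unit: "B (unit_vector R n i) = b i" if "i < n" for i
  proof -
    have "B (unit_vector R n i) = (\<Oplus>j\<in>{..<n}. if i = j then b j else \<zero>)"
      unfolding B_def by (rule M.R.finsum_cong') (use that b(1) in \<open>auto simp: unit_vector_def\<close>)
    also have "\<dots> = b i" by (rule M.R.finsum_singleton) (use that b(1) in auto)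
    finally show ?thesis .
  qed
  have B_zero: "B \<zero>\<^bsub>Fn\<^esub> = \<zero>"
    using B_smult[of \<zero> "\<zero>\<^bsub>Fn\<^esub>"] B_cl[of "\<zero>\<^bsub>Fn\<^esub>"] by (simp add: Fn.smult_zero)
  have Bx: "B w \<odot>\<^bsub>M\<^esub> x = f w" if "w \<in> carrier Fn" for w
    using R that unfolding Fn_def
    by (induction w rule: free_left_module_induct; fold Fn_def)
      (simp_all add: B_zero f_zero x M.smult_zero B_unit b(2) B_add B_smult f_add f_smult B_cl
        M.smult_l_distr M.smult_assoc1)

  obtain y where y: "y \<in> carrier Fn" "f y = x" using surj x by (metis Fn_def imageE)
  define G where "G = insert (\<one> \<ominus> B y) ((\<lambda>j. B (g (unit_vector R m j))) ` {..<m})"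
  have "G \<subseteq> {a \<in> carrier R. a \<odot>\<^bsub>M\<^esub> x = \<zero>\<^bsub>M\<^esub>}"
  proof -
    have "(\<one> \<ominus> B y) \<odot>\<^bsub>M\<^esub> x \<oplus>\<^bsub>M\<^esub> B y \<odot>\<^bsub>M\<^esub> x = (\<one> \<ominus> B y \<oplus> B y) \<odot>\<^bsub>M\<^esub> x"
      using B_cl[OF y(1)] x by (simp add: M.smult_l_distr)
    also have "\<one> \<ominus> B y \<oplus> B y = \<one>"
      using B_cl[OF y(1)] by (simp add: M.R.minus_eq M.R.a_assoc M.R.l_neg)
    finally have "(\<one> \<ominus> B y) \<odot>\<^bsub>M\<^esub> x \<oplus>\<^bsub>M\<^esub> x = x" using Bx[OF y(1)] y(2) x by simp
    then have "(\<one> \<ominus> B y) \<odot>\<^bsub>M\<^esub> x = \<zero>\<^bsub>M\<^esub>"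
      using x B_cl[OF y(1)] M.M.add.r_cancel_one by simp
    moreover have "B (g (unit_vector R m j)) \<odot>\<^bsub>M\<^esub> x = \<zero>\<^bsub>M\<^esub>" for j
      using Bx[OF g_cl[OF uv(2)]] exact uv(2)[of j] by (auto simp: Fm_def)
    ultimately show ?thesis using B_cl[OF y(1)] B_cl[OF g_cl[OF uv(2)]] by (auto simp: G_def)
  qed
  moreover have "{a \<in> carrier R. a \<odot>\<^bsub>M\<^esub> x = \<zero>\<^bsub>M\<^esub>} \<subseteq> H" if H: "left_ideal R H" "G \<subseteq> H" for H
  proof
    fix a assume "a \<in> {a \<in> carrier R. a \<odot>\<^bsub>M\<^esub> x = \<zero>\<^bsub>M\<^esub>}"
    then have a: "a \<in> carrier R" "a \<odot>\<^bsub>M\<^esub> x = \<zero>\<^bsub>M\<^esub>" by auto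
    have BgH: "B (g z) \<in> H" if "z \<in> carrier Fm" for z
      using R that unfolding Fm_def
      by (induction z rule: free_left_module_induct; fold Fm_def)
        (use H in \<open>auto simp: g_zero B_zero g_add g_smult B_add B_smult g_cl G_def left_ideal_def\<close>)
    have "f (a \<odot>\<^bsub>Fn\<^esub> y) = \<zero>\<^bsub>M\<^esub>" using f_smult a y by simp
    moreover have "a \<odot>\<^bsub>Fn\<^esub> y \<in> carrier Fn" using a(1) y(1) by simp
    ultimately obtain z where "z \<in> carrier Fm" "g z = a \<odot>\<^bsub>Fn\<^esub> y"
      using exact unfolding folds by (metis (mono_tags, lifting) imageE mem_Collect_eq)
    then have "a \<otimes> B y \<in> H" using BgH B_smult a(1) y(1) by metis
    moreover have "a \<otimes> (\<one> \<ominus> B y) \<in> H" using H a(1) by (auto simp: left_ideal_def G_def)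
    ultimately have "a \<otimes> (\<one> \<ominus> B y) \<oplus> a \<otimes> B y \<in> H" using H by (auto simp: left_ideal_def)
    moreover have "a \<otimes> (\<one> \<ominus> B y) \<oplus> a \<otimes> B y = a"
      using a(1) B_cl[OF y(1)]
      by (simp add: M.R.minus_eq M.R.a_assoc M.R.l_neg flip: M.R.r_distr)
    ultimately show "a \<in> H" by simp
  qed
  moreover have "finite G" by (simp add: G_def)
  ultimately show ?thesis by blast
qed

lemma finitely_presented_cyclicI:
  fixes R (structure) and M (structure)
  assumes "left_module R M" and x: "x \<in> carrier M" "carrier M \<subseteq> (\<lambda>a. a \<odot>\<^bsub>M\<^esub> x) ` carrier R"
    and r: "r \<in> carrier R" "r \<odot>\<^bsub>M\<^esub> x = \<zero>\<^bsub>M\<^esub>"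
    and ann: "\<And>a. a \<in> carrier R \<Longrightarrow> a \<odot>\<^bsub>M\<^esub> x = \<zero>\<^bsub>M\<^esub> \<Longrightarrow> \<exists>b \<in> carrier R. a = b \<otimes> r"
  shows "finitely_presented R M"
proof -
  interpret M: left_module R M by fact
  let ?F = "free_left_module R 1"
  let ?g = "\<lambda>w. \<lambda>i\<in>{..<1::nat}. w (0::nat) \<otimes> r" and ?f = "\<lambda>w. w (0::nat) \<odot>\<^bsub>M\<^esub> x"
  have single: "(\<lambda>i\<in>{..<1}. a) \<in> carrier ?F" if "a \<in> carrier R" for a
    using that by (auto simp: free_left_module_simps)
  have at0: "w 0 \<in> carrier R" if "w \<in> carrier ?F" for w
    using that by (auto simp: free_left_module_simps)
  have eq: "w = (\<lambda>i\<in>{..<1}. w 0)" if "w \<in> carrier ?F" for w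
    using that by (intro ext) (auto simp: free_left_module_simps PiE_def extensional_def)
  have "?g \<in> left_module_hom R ?F ?F"
    using r(1) at0 by (auto simp: left_module_hom_def free_left_module_simps M.R.l_distr M.R.m_assoc)
  moreover have "?f \<in> left_module_hom R ?F M"
    using x(1) at0 by (auto simp: left_module_hom_def free_left_module_simps M.smult_l_distr M.smult_assoc1)
  moreover have "?f ` carrier ?F = carrier M"
  proof
    show "carrier M \<subseteq> ?f ` carrier ?F"
    proof
      fix y assume "y \<in> carrier M"
      then obtain a where "a \<in> carrier R" "y = a \<odot>\<^bsub>M\<^esub> x" using x(2) by blast
      with single show "y \<in> ?f ` carrier ?F" by (intro image_eqI[of _ _ "\<lambda>i\<in>{..<1}. a"]) auto
    qed
  qed (use at0 x(1) in auto)
  moreover have "?g ` carrier ?F = {w \<in> carrier ?F. ?f w = \<zero>\<^bsub>M\<^esub>}"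
  proof
    have "a \<odot>\<^bsub>M\<^esub> \<zero>\<^bsub>M\<^esub> = \<zero>\<^bsub>M\<^esub>" if "a \<in> carrier R" for a
      using M.smult_assoc1[of a \<zero> "\<zero>\<^bsub>M\<^esub>"] that by (simp add: M.smult_zero)
    then show "?g ` carrier ?F \<subseteq> {w \<in> carrier ?F. ?f w = \<zero>\<^bsub>M\<^esub>}"
      using at0 r x(1) by (auto simp: single[unfolded One_nat_def] M.smult_assoc1)
    show "{w \<in> carrier ?F. ?f w = \<zero>\<^bsub>M\<^esub>} \<subseteq> ?g ` carrier ?F"
    proof
      fix w assume w: "w \<in> {w \<in> carrier ?F. ?f w = \<zero>\<^bsub>M\<^esub>}"
      then obtain b where b: "b \<in> carrier R" "w 0 = b \<otimes> r" using ann[of "w 0"] at0 by auto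
      then have "w = ?g (\<lambda>i\<in>{..<1}. b)" using eq[of w] w by simp
      then show "w \<in> ?g ` carrier ?F" using single[OF b(1)] by (rule image_eqI)
    qed
  qed
  ultimately show ?thesis unfolding finitely_presented_def by blast
qed


section \<open>A representation that separates the edges at a vertex\<close>

text \<open>Infinite paths cannot separate an edge from zero if it leads only to sinks. Therefore each vertex
\<open>v\<close> gets a copy of the natural numbers, and for a vertex that emits edges this copy is put in bijection
with the disjoint union of the copies at the ranges of these edges. This works because a
countably infinite set is a union of any finite positive number of countably infinite sets. The
algebra acts on the functions on the union of all copies, an edge by extending a function
by zero from its part.\<close>

definition edge_code :: "('v, 'e) pre_digraph \<Rightarrow> 'e \<Rightarrow> nat \<Rightarrow> nat"
  where "edge_code E e y = to_nat_on (out_arcs E (tail E e) \<times> (UNIV :: nat set)) (e, y)"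

definition edge_decode :: "('v, 'e) pre_digraph \<Rightarrow> 'v \<Rightarrow> nat \<Rightarrow> 'e \<times> nat"
  where "edge_decode E v = from_nat_into (out_arcs E v \<times> UNIV)"

lemma
  assumes "fin_digraph E"
  shows edge_decode_code: "e \<in> arcs E \<Longrightarrow> edge_decode E (tail E e) (edge_code E e y) = (e, y)"
    and edge_decode: "out_arcs E v \<noteq> {} \<Longrightarrow> edge_decode E v x = (e, y) \<Longrightarrow>
      e \<in> arcs E \<and> tail E e = v \<and> edge_code E e y = x"
proof -
  interpret fin_digraph E by fact
  have fin: "finite (out_arcs E v)" for v by (rule finite_subset[OF _ finite_arcs]) auto
  have c: "countable (out_arcs E v \<times> (UNIV :: nat set))" for v
    by (rule countable_SIGMA) (simp_all add: countable_finite fin)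
  show "edge_decode E (tail E e) (edge_code E e y) = (e, y)" if "e \<in> arcs E"
    using that c unfolding edge_decode_def edge_code_def by (subst from_nat_into_to_nat_on) auto
  show "e \<in> arcs E \<and> tail E e = v \<and> edge_code E e y = x"
    if ne: "out_arcs E v \<noteq> {}" and d: "edge_decode E v x = (e, y)"
  proof -
    have "infinite (out_arcs E v \<times> (UNIV :: nat set))" using ne by (simp add: finite_cartesian_product_iff)
    from to_nat_on_from_nat_into_infinite[OF c this, of x]
    have x: "to_nat_on (out_arcs E v \<times> UNIV) (e, y) = x" using d by (simp add: edge_decode_def)
    have "(e, y) \<in> out_arcs E v \<times> (UNIV :: nat set)"
      using from_nat_into[of "out_arcs E v \<times> (UNIV :: nat set)" x] ne d by (simp add: edge_decode_def)
    with x show ?thesis by (auto simp: edge_code_def)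
  qed
qed

fun gen_op :: "('v, 'e) pre_digraph \<Rightarrow> ('v, 'e) lpa_gen \<Rightarrow> ('v \<times> nat \<Rightarrow> 'k::field) \<Rightarrow> 'v \<times> nat \<Rightarrow> 'k"
  where
    "gen_op E (Vertex v) \<phi> (u, x) = (if u = v then \<phi> (u, x) else 0)"
  | "gen_op E (Edge e) \<phi> (u, x) =
      (if u = tail E e \<and> fst (edge_decode E u x) = e then \<phi> (head E e, snd (edge_decode E u x)) else 0)"
  | "gen_op E (Ghost e) \<phi> (u, x) = (if u = head E e then \<phi> (tail E e, edge_code E e x) else 0)"

definition word_op :: "('v, 'e) pre_digraph \<Rightarrow> ('v, 'e) lpa_gen list \<Rightarrow> ('v \<times> nat \<Rightarrow> 'k::field) \<Rightarrow> 'v \<times> nat \<Rightarrow> 'k"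
  where "word_op E ws = foldr (gen_op E) ws"

definition free_op :: "('v, 'e) pre_digraph \<Rightarrow> ('v, 'e, 'k::field) lpa_free \<Rightarrow> ('v \<times> nat \<Rightarrow> 'k) \<Rightarrow> 'v \<times> nat \<Rightarrow> 'k"
  where "free_op E f \<phi> d = (\<Sum>w \<in> Poly_Mapping.keys f. Poly_Mapping.lookup f w * word_op E (letters w) \<phi> d)"

lemma gen_op_sum:
  "gen_op E g (\<lambda>d. \<Sum>i\<in>A. c i * \<phi> i d) = (\<lambda>d. \<Sum>i\<in>A. c i * gen_op E g (\<phi> i) d)"
proof (rule ext)
  fix d :: "'a \<times> nat"
  obtain u x where "d = (u, x)" by (cases d)
  then show "gen_op E g (\<lambda>d. \<Sum>i\<in>A. c i * \<phi> i d) d = (\<Sum>i\<in>A. c i * gen_op E g (\<phi> i) d)"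
  proof (cases g)
    case (Edge e)
    show ?thesis
    proof (cases "u = tail E e \<and> fst (edge_decode E u x) = e")
      case True
      then show ?thesis by (simp add: Edge \<open>d = (u, x)\<close>)
    next
      case False
      then show ?thesis by (simp only: Edge \<open>d = (u, x)\<close> gen_op.simps if_False mult_zero_right sum.neutral_const)
    qed
  qed auto
qed

lemma word_op_sum:
  "word_op E ws (\<lambda>d. \<Sum>i\<in>A. c i * \<phi> i d) = (\<lambda>d. \<Sum>i\<in>A. c i * word_op E ws (\<phi> i) d)"
  by (induction ws) (simp_all add: word_op_def gen_op_sum)

lemma free_op_superset:
  assumes "finite W" "Poly_Mapping.keys f \<subseteq> W"
  shows "free_op E f \<phi> d = (\<Sum>w \<in> W. Poly_Mapping.lookup f w * word_op E (letters w) \<phi> d)"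
  unfolding free_op_def by (rule sum.mono_neutral_left) (use assms in \<open>auto simp: in_keys_iff\<close>)

lemma free_op_add: "free_op E (f + g) \<phi> d = free_op E f \<phi> d + free_op E g \<phi> d"
proof -
  let ?W = "Poly_Mapping.keys f \<union> Poly_Mapping.keys g"
  have "free_op E h \<phi> d = (\<Sum>w \<in> ?W. Poly_Mapping.lookup h w * word_op E (letters w) \<phi> d)"
    if "h \<in> {f, g, f + g}" for h
    by (rule free_op_superset) (use that keys_add[of f g] in auto)
  then show ?thesis by (simp add: sum.distrib[symmetric] lookup_add distrib_right)
qed

lemma free_op_zero: "free_op E 0 \<phi> d = 0"
  by (simp add: free_op_def)

lemma free_op_sum: "free_op E (sum h A) \<phi> d = (\<Sum>i\<in>A. free_op E (h i) \<phi> d)"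
  by (induction A rule: infinite_finite_induct) (simp_all add: free_op_add free_op_zero)

lemma free_op_diff: "free_op E (f - g) \<phi> d = free_op E f \<phi> d - free_op E g \<phi> d"
  using free_op_add[of E "f - g" g \<phi> d] by simp

lemma free_op_single: "free_op E (Poly_Mapping.single w a) \<phi> d = a * word_op E (letters w) \<phi> d"
  by (subst free_op_superset[of "{w}"]) auto

lemma free_op_gen: "free_op E (gen x) \<phi> = gen_op E x \<phi>"
  by (rule ext) (simp add: gen_def free_op_single word_op_def)

lemma free_op_mult: "free_op E (f * g) \<phi> = free_op E f (free_op E g \<phi>)"
proof (rule ext)
  fix d
  let ?s = "\<lambda>h w. Poly_Mapping.single w (Poly_Mapping.lookup h w)"
  have "free_op E (f * g) \<phi> d = free_op E ((\<Sum>u \<in> Poly_Mapping.keys f. ?s f u) * (\<Sum>w \<in> Poly_Mapping.keys g. ?s g w)) \<phi> d"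
    by (simp only: poly_mapping_expand)
  also have "\<dots> = (\<Sum>u \<in> Poly_Mapping.keys f. \<Sum>w \<in> Poly_Mapping.keys g.
      Poly_Mapping.lookup f u * Poly_Mapping.lookup g w * word_op E (letters u) (word_op E (letters w) \<phi>) d)"
    by (simp add: sum_distrib_left sum_distrib_right free_op_sum mult_single free_op_single word_op_def
        sum.swap[of _ "Poly_Mapping.keys g"])
  also have "\<dots> = free_op E f (\<lambda>d. \<Sum>w \<in> Poly_Mapping.keys g. Poly_Mapping.lookup g w * word_op E (letters w) \<phi> d) d"
    by (simp add: free_op_def[of E f] word_op_sum sum_distrib_left mult.assoc)
  finally show "free_op E (f * g) \<phi> d = free_op E f (free_op E g \<phi>) d"
    by (simp add: free_op_def[of E g, abs_def])
qed

lemma free_op_zero_right: "free_op E f (\<lambda>_. 0) = (\<lambda>_. 0)"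
  using free_op_mult[of E f 0 "\<lambda>_. 0"] by (simp add: free_op_zero[abs_def])

lemma relation_free_op:
  fixes E :: "('v, 'e) pre_digraph" and \<phi> :: "'v \<times> nat \<Rightarrow> 'k::field"
  assumes "fin_digraph E" "r \<in> lpa_relations E"
  shows "free_op E r \<phi> = (\<lambda>_. 0)"
proof (rule ext)
  fix d :: "'v \<times> nat"
  obtain u x where d: "d = (u, x)" by (cases d)
  interpret fin_digraph E by fact
  note dec = edge_decode_code[OF assms(1)]
  have fin: "finite (out_arcs E v)" for v by (rule finite_subset[OF _ finite_arcs]) auto
  \<comment> \<open>the relation at a regular vertex: each point of its copy lies in the part of exactly one edge\<close>
  have ck: "(\<Sum>e \<in> out_arcs E v. gen_op E (Edge e) (gen_op E (Ghost e) \<phi>) (u, x)) = gen_op E (Vertex v) \<phi> (u, x)"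
    if "out_arcs E v \<noteq> {}" for v
  proof (cases "u = v")
    case True
    obtain e y where ey: "edge_decode E v x = (e, y)" by (cases "edge_decode E v x")
    note e = edge_decode[OF assms(1) that ey]
    have "(\<Sum>f \<in> out_arcs E v. gen_op E (Edge f) (gen_op E (Ghost f) \<phi>) (u, x))
      = (\<Sum>f \<in> out_arcs E v. if f = e then \<phi> (v, x) else 0)"
      by (rule sum.cong) (use True ey e in \<open>auto simp: out_arcs_def\<close>)
    also have "\<dots> = \<phi> (v, x)" using e fin by (auto simp: sum.delta)
    finally show ?thesis using True by simp
  next
    case False
    then show ?thesis by (auto intro!: sum.neutral)
  qed
  show "free_op E r \<phi> d = 0"
  proof (cases "\<exists>v. regular_vertex E v \<and>
      r = gen (Vertex v) - (\<Sum>e \<in> out_arcs E v. gen (Edge e) * gen (Ghost e))")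
    case True
    then obtain v where v: "out_arcs E v \<noteq> {}"
      "r = gen (Vertex v) - (\<Sum>e \<in> out_arcs E v. gen (Edge e) * gen (Ghost e))"
      by (auto simp: regular_vertex_def)
    show ?thesis
      unfolding v(2) d by (simp only: free_op_diff free_op_mult free_op_gen free_op_sum ck[OF v(1)] diff_self)
  next
    case False
    then show ?thesis
      using assms(2) unfolding lpa_relations_def d
      by (auto simp: free_op_diff free_op_mult free_op_gen dec)
  qed
qed

lemma lpa_ideal_free_op:
  fixes E :: "('v, 'e) pre_digraph" and r :: "('v, 'e, 'k::field) lpa_free"
  assumes "fin_digraph E" "r \<in> lpa_ideal E"
  shows "free_op E r \<phi> = (\<lambda>_. 0)"
proof -
  let ?F = "free_algebra (lpa_gens E) :: ('v, 'e, 'k::field) lpa_free ring"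
  let ?K = "{f \<in> carrier ?F. \<forall>\<phi>. free_op E f \<phi> = (\<lambda>_. 0)}"
  interpret fin_digraph E by fact
  interpret F: ring ?F by (rule ring_free_algebra)
  have "ideal ?K ?F"
  proof (rule idealI)
    show "subgroup ?K (add_monoid ?F)"
    proof (rule F.add.subgroupI)
      fix f assume f: "f \<in> ?K"
      have "\<ominus>\<^bsub>?F\<^esub> f = - f"
        by (rule F.minus_equality) (use f in \<open>auto intro: free_algebra_uminus\<close>)
      moreover have "free_op E (- f) \<phi> d = - free_op E f \<phi> d" for \<phi> d
        using free_op_diff[of E 0 f \<phi> d] by (simp add: free_op_zero)
      ultimately show "\<ominus>\<^bsub>?F\<^esub> f \<in> ?K" using f by (auto simp: free_algebra_uminus fun_eq_iff)
    next
      have "0 \<in> ?K" by (simp add: free_algebra_carrier free_op_zero fun_eq_iff)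
      then show "?K \<noteq> {}" by blast
    qed (auto simp: free_algebra_add free_op_add fun_eq_iff)
  qed (auto simp: ring_free_algebra free_algebra_mult free_op_mult free_op_zero_right)
  moreover have "lpa_relations E \<subseteq> ?K"
    using relation_free_op[OF assms(1)] lpa_relations_subset[OF wf_digraph_axioms] by blast
  ultimately have "lpa_ideal E \<subseteq> ?K" by (rule F.genideal_minimal)
  with assms show ?thesis by blast
qed

text \<open>The constant function 1 is not killed at a point of the part that belongs to \<open>f\<close>.\<close>

lemma branching_edge_not_full:
  assumes "fin_digraph E" "e \<in> arcs E" "f \<in> arcs E" "tail E f = tail E e" "f \<noteq> e"
  shows "gen (Vertex (tail E e)) - gen (Edge e) * gen (Ghost e) \<notin> (lpa_ideal E :: ('v, 'e, 'k::field) lpa_free set)"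
proof
  let ?r = "gen (Vertex (tail E e)) - gen (Edge e) * gen (Ghost e) :: ('v, 'e, 'k) lpa_free"
  assume "?r \<in> lpa_ideal E"
  from lpa_ideal_free_op[OF assms(1) this, of "\<lambda>_. 1"]
  have "free_op E ?r (\<lambda>_. 1) (tail E e, edge_code E f 0) = 0" by simp
  moreover have "edge_decode E (tail E e) (edge_code E f 0) = (f, 0)"
    using edge_decode_code[OF assms(1,3), of 0] assms(4) by simp
  ultimately show False
    using assms(5) by (simp add: free_op_diff free_op_mult free_op_gen)
qed


section \<open>Generators of the module of a tail class\<close>

lemma word_act_ghosts: "word_act E (map Ghost (rev (stake n q))) q = Some (sdrop n q)"
proof (induction n arbitrary: q)
  case (Suc n)
  then show ?case by (simp add: word_act_append del: sdrop_simps)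
qed simp

lemma word_act_path: "q \<in> infinite_paths E \<Longrightarrow> word_act E (map Edge (stake n q)) (sdrop n q) = Some q"
proof (induction n arbitrary: q)
  case (Suc n)
  note q = infinite_pathsD[OF Suc.prems]
  show ?case using Suc.IH[OF q(2)] q by simp
qed simp

lemma tail_class_trans:
  assumes "q \<in> tail_class E p" "z \<in> tail_class E p"
  shows "\<exists>m>0. \<exists>n>0. sdrop m z = sdrop n q"
proof -
  obtain a b c d where ab: "b > 0" "sdrop a p = sdrop b q" and cd: "d > 0" "sdrop c p = sdrop d z"
    using assms by (auto simp: tail_class_def tail_equivalent_def)
  have "sdrop (d + a) z = sdrop (c + a) p" using cd by (metis sdrop_add)
  also have "\<dots> = sdrop (b + c) q" using ab by (metis sdrop_add add.commute)
  finally show ?thesis using ab(1) cd(1) by (intro exI[of _ "d + a"] exI[of _ "b + c"] conjI) auto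
qed

text \<open>From \<open>z\<close> one reaches any tail-equivalent \<open>q\<close> by removing an initial segment with ghost edges and
adding one with edges.\<close>

lemma path_module_cyclic:
  fixes x :: "'e stream \<Rightarrow>\<^sub>0 'k::field" and E :: "('v, 'e) pre_digraph"
  assumes z: "z \<in> tail_class E p" and x: "x \<in> carrier (path_module E p)"
  shows "\<exists>f \<in> augmentation E. free_act E f (Poly_Mapping.single z 1) = x"
proof -
  have "\<exists>ws. ws \<noteq> [] \<and> set ws \<subseteq> lpa_gens E \<and> word_act E ws z = Some q" if q: "q \<in> tail_class E p" for q
  proof -
    obtain m n where mn: "n > 0" "sdrop m z = sdrop n q" using tail_class_trans[OF q z] by blast
    let ?ws = "map Edge (stake n q) @ map Ghost (rev (stake m z))"
    have inf: "q \<in> infinite_paths E" "z \<in> infinite_paths E" using q z by (simp_all add: tail_class_def)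
    have "word_act E ?ws z = Some q"
      using word_act_path[OF inf(1), of n] by (simp add: word_act_append word_act_ghosts mn(2) del: rev_map)
    moreover have "set ?ws \<subseteq> lpa_gens E"
      using infinite_pathsD(4)[OF inf(1), of n] infinite_pathsD(4)[OF inf(2), of m] by auto
    ultimately show ?thesis using mn(1) by (intro exI[of _ ?ws]) auto
  qed
  then obtain w where w: "w q \<noteq> []" "set (w q) \<subseteq> lpa_gens E" "word_act E (w q) z = Some q"
    if "q \<in> tail_class E p" for q by metis
  have keys: "Poly_Mapping.keys x \<subseteq> tail_class E p" using x by (simp add: carrier_path_module)
  define f where "f = (\<Sum>q \<in> Poly_Mapping.keys x. Poly_Mapping.single (Wd (w q)) (Poly_Mapping.lookup x q))"
  have "f \<in> augmentation E"
    unfolding f_def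
  proof (rule augmentation_sum)
    fix q assume "q \<in> Poly_Mapping.keys x"
    with keys have "q \<in> tail_class E p" by blast
    from w[OF this] show "Poly_Mapping.single (Wd (w q)) (Poly_Mapping.lookup x q) \<in> augmentation E"
      by (auto simp: augmentation_def free_algebra_carrier lookup_single zero_free_monoid_def)
  qed
  moreover have "free_act E f (Poly_Mapping.single z 1)
      = (\<Sum>q \<in> Poly_Mapping.keys x. Poly_Mapping.single q (Poly_Mapping.lookup x q))"
    unfolding f_def free_act_sum_left
    by (rule sum.cong) (use w keys in \<open>auto simp: free_act_single subset_iff\<close>)
  ultimately show ?thesis by (metis poly_mapping_expand)
qed

lemma path_module_single: "z \<in> tail_class E p \<Longrightarrow> Poly_Mapping.single z a \<in> carrier (path_module E p)"
  by (simp add: carrier_path_module)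

lemma path_module_cyclic_lpa:
  fixes E :: "('v, 'e) pre_digraph"
  assumes "wf_digraph E" "z \<in> tail_class E p"
  shows "carrier (path_module E p) \<subseteq> (\<lambda>X. X \<odot>\<^bsub>path_module E p\<^esub> Poly_Mapping.single z 1) `
    carrier (leavitt_path_algebra E :: (('v, 'e, 'k::field) lpa_free set) ring)"
proof
  fix x :: "'e stream \<Rightarrow>\<^sub>0 'k" assume "x \<in> carrier (path_module E p)"
  then obtain f :: "('v, 'e, 'k) lpa_free" where "f \<in> augmentation E" "free_act E f (Poly_Mapping.single z 1) = x"
    using path_module_cyclic[OF assms(2)] by blast
  then show "x \<in> (\<lambda>X. X \<odot>\<^bsub>path_module E p\<^esub> Poly_Mapping.single z 1) `
      carrier (leavitt_path_algebra E :: (('v, 'e, 'k) lpa_free set) ring)"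
    using path_module_smult[OF assms(1) augmentationD path_module_single[OF assms(2)], of f 1]
    by (auto simp: carrier_lpa intro!: image_eqI[of _ _ "lpa_class E f"])
qed


section \<open>Eventually periodic paths\<close>

text \<open>For a purely periodic path two initial segments with the same continuation differ by a power of the
closed path \<open>c\<close> that runs through the least period, and right multiplication by \<open>c\<close> changes
nothing modulo the left ideal generated by \<open>1 - c\<close>. Minimality of the period matters: for a
proper multiple of it the left ideal would be too small.\<close>

lemma periodic_annihilator:
  fixes E :: "('v, 'e) pre_digraph" and f :: "('v, 'e, 'k::field) lpa_free"
  assumes "wf_digraph E" "z \<in> infinite_paths E"
    and d: "d > 0" "sdrop d z = z" "\<And>b. 0 < b \<Longrightarrow> sdrop b z = z \<Longrightarrow> d \<le> b"
    and f: "f \<in> carrier (free_algebra (lpa_gens E))" "free_act E f (Poly_Mapping.single z 1) = 0"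
  shows "\<exists>a \<in> carrier (free_algebra (lpa_gens E)). f - a * (1 - path (stake d z)) \<in> lpa_ideal E"
proof -
  let ?F = "free_algebra (lpa_gens E) :: ('v, 'e, 'k) lpa_free ring"
  let ?c = "path (stake d z) :: ('v, 'e, 'k) lpa_free"
  define J where "J = {h \<in> carrier ?F. \<exists>a \<in> carrier ?F. h - a * (1 - ?c) \<in> lpa_ideal E}"
  note I = left_ideal_free[OF left_ideal_lpa_ideal[OF assms(1)]]
  have scal: "1 \<in> carrier ?F" "0 \<in> carrier ?F" by (simp_all add: free_algebra_carrier)
  have pathF: "path (stake n q) \<in> carrier ?F" if "q \<in> infinite_paths E" for n q
    by (rule path_in_free_algebra[OF infinite_pathsD(4)[OF that]])
  have J: "left_ideal ?F J"
    unfolding left_ideal_def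
  proof (intro conjI ballI)
    show "\<zero>\<^bsub>?F\<^esub> \<in> J" using I(1) scal by (auto simp: J_def intro!: bexI[of _ 0])
  next
    fix g h assume "g \<in> J" "h \<in> J"
    then obtain a b where ab: "a \<in> carrier ?F" "g - a * (1 - ?c) \<in> lpa_ideal E" "g \<in> carrier ?F"
      "b \<in> carrier ?F" "h - b * (1 - ?c) \<in> lpa_ideal E" "h \<in> carrier ?F" by (auto simp: J_def)
    from I(2)[OF ab(2,5)] have "g + h - (a + b) * (1 - ?c) \<in> lpa_ideal E" by (simp add: algebra_simps)
    with ab free_algebra_add[OF ab(1,4)] show "g \<oplus>\<^bsub>?F\<^esub> h \<in> J" by (auto simp: J_def free_algebra_add)
  next
    fix b g assume b: "b \<in> carrier ?F" and "g \<in> J"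
    then obtain a where a: "a \<in> carrier ?F" "g - a * (1 - ?c) \<in> lpa_ideal E" "g \<in> carrier ?F"
      by (auto simp: J_def)
    from I(4)[OF b a(2)] have "b * g - (b * a) * (1 - ?c) \<in> lpa_ideal E" by (simp add: algebra_simps)
    with a b free_algebra_mult[OF b a(1)] show "b \<otimes>\<^bsub>?F\<^esub> g \<in> J" by (auto simp: J_def free_algebra_mult)
  qed (auto simp: J_def)
  note Jc = left_ideal_free[OF J]
  have IJ: "lpa_ideal E \<subseteq> J" using I(5) scal by (auto simp: J_def intro!: bexI[of _ 0])
  have c: "1 - ?c \<in> J"
    using I(1) scal pathF[OF assms(2)] free_algebra_diff[OF scal(1) pathF[OF assms(2)]]
    by (auto simp: J_def intro!: bexI[of _ 1])
  have ck: "1 - path (stake (k * d) z) \<in> J" for k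
  proof (induction k)
    case 0
    then show ?case using Jc(1) by (simp add: word_Nil)
  next
    case (Suc k)
    have "stake (Suc k * d) z = stake d z @ stake (k * d) z"
      using stake_add[of d z "k * d"] d(2) by simp
    then have "(1 - path (stake (Suc k * d) z) :: ('v, 'e, 'k) lpa_free) = (1 - ?c) + ?c * (1 - path (stake (k * d) z))"
      by (simp add: word_append algebra_simps)
    then show ?case using Jc(2)[OF c Jc(4)[OF pathF[OF assms(2)] Suc]] by (simp only:)
  qed
  have t: "path (stake a q) - path (stake b q) \<in> J"
    if "q \<in> infinite_paths E" "sdrop a q = z" "sdrop b q = z" "a \<le> b" for q a b
  proof -
    have "sdrop (b - a) z = z" using that(2-4) by (metis sdrop_add le_add_diff_inverse)
    then obtain k where "b - a = k * d"
      using least_period_dvd[OF d(2,3,1)] by (metis dvd_div_mult_self)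
    then have "b = a + k * d" using that(4) by simp
    then have "stake b q = stake a q @ stake (k * d) z" using stake_add[of a q "k * d"] that(2) by simp
    then have "(path (stake a q) - path (stake b q) :: ('v, 'e, 'k) lpa_free)
        = path (stake a q) * (1 - path (stake (k * d) z))"
      by (simp add: word_append algebra_simps)
    then show ?thesis using Jc(4)[OF pathF[OF that(1)] ck] by simp
  qed
  \<comment> \<open>a multiple of the period that is long enough for all words of \<open>f\<close>\<close>
  define n where "n = Max ((\<lambda>w. length (letters w) + 2) ` Poly_Mapping.keys f)"
  have n: "length (letters w) + 2 \<le> n * d" if "w \<in> Poly_Mapping.keys f" for w
  proof -
    have "length (letters w) + 2 \<le> n" unfolding n_def by (rule Max_ge) (use that in auto)
    then show ?thesis using d(1) by (metis le_trans mult.right_neutral mult_le_mono2 Suc_leI One_nat_def)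
  qed
  have nz: "sdrop (n * d) z = z" by (rule sdrop_mult_period[OF d(2)])
  have "f * path (stake (n * d) z) \<in> J"
  proof (rule annihilator_times_path[OF assms(1,2) f J IJ n])
    fix q a b assume *: "q \<in> infinite_paths E" "sdrop a q = sdrop (n * d) z" "sdrop b q = sdrop (n * d) z"
    show "path (stake a q) - path (stake b q) \<in> J"
    proof (cases "a \<le> b")
      case True
      then show ?thesis using t[of q a b] * nz by simp
    next
      case False
      then have "path (stake b q) - path (stake a q) \<in> J" using t[of q b a] * nz by simp
      from Jc(3)[OF Jc(1) this] show ?thesis by simp
    qed
  qed
  from Jc(2)[OF this Jc(4)[OF f(1) ck[of n]]] have "f \<in> J" by (simp add: algebra_simps)
  then show ?thesis by (simp add: J_def)
qed

text \<open>The presentation has one generator and one relation, \<open>1 - c\<close>.\<close>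

lemma periodic_finitely_presented:
  fixes E :: "('v, 'e) pre_digraph" and p :: "'e stream"
  assumes "fin_digraph E" "p \<in> infinite_paths E" "i < j" "sdrop i p = sdrop j p"
  shows "finitely_presented (leavitt_path_algebra E :: (('v, 'e, 'k::field) lpa_free set) ring) (path_module E p)"
    (is "finitely_presented ?L ?M")
proof -
  interpret fin_digraph E by fact
  define z where "z = sdrop i p"
  have "sdrop (j - i) z = z" using assms(3,4) unfolding z_def by (metis sdrop_add less_imp_le le_add_diff_inverse)
  moreover define d where "d = (LEAST d. 0 < d \<and> sdrop d z = z)"
  ultimately have d: "d > 0" "sdrop d z = z" "\<And>b. 0 < b \<Longrightarrow> sdrop b z = z \<Longrightarrow> d \<le> b"
    using LeastI[of "\<lambda>d. 0 < d \<and> sdrop d z = z" "j - i"] assms(3)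
      Least_le[of "\<lambda>d. 0 < d \<and> sdrop d z = z"] by auto
  have z: "z \<in> infinite_paths E" unfolding z_def by (rule sdrop_infinite_paths[OF assms(2)])
  have "sdrop (Suc i) p = sdrop 1 z" unfolding z_def by (metis sdrop_add add.commute plus_1_eq_Suc)
  then have zc: "z \<in> tail_class E p"
    using z unfolding tail_class_def tail_equivalent_def by blast
  let ?c = "path (stake d z) :: ('v, 'e, 'k) lpa_free"
  define s where "s = (\<Sum>v \<in> verts E. gen (Vertex v) :: ('v, 'e, 'k) lpa_free)"
  let ?x = "Poly_Mapping.single z 1 :: 'e stream \<Rightarrow>\<^sub>0 'k"
  have x: "?x \<in> carrier ?M" by (rule path_module_single[OF zc])
  have s: "s \<in> augmentation E" unfolding s_def by (rule vertex_sum_augmentation)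
  have ca: "?c \<in> augmentation E"
    by (rule word_augmentation) (use infinite_pathsD(4)[OF z, of d] d(1) in auto)
  have sc: "s - ?c \<in> augmentation E"
    using augmentation_closed(2)[OF s augmentation_closed(3)[OF ca]] by simp
  have F: "f \<in> carrier (free_algebra (lpa_gens E))" if "f \<in> augmentation E" for f :: "('v, 'e, 'k) lpa_free"
    by (rule augmentationD[OF that])
  have smult: "lpa_class E f \<odot>\<^bsub>?M\<^esub> ?x = free_act E f ?x" if "f \<in> augmentation E" for f :: "('v, 'e, 'k) lpa_free"
    by (rule path_module_smult[OF wf_digraph_axioms F[OF that] x])
  show ?thesis
  proof (rule finitely_presented_cyclicI[OF left_module_path_module[OF assms(1)] x
        path_module_cyclic_lpa[OF wf_digraph_axioms zc]])
    show "lpa_class E (s - ?c) \<in> carrier ?L" using sc by (auto simp: carrier_lpa)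
    have "free_act E ?c ?x = ?x"
      using word_act_path[OF z, of d] d(2) by (simp add: free_act_single)
    then show "lpa_class E (s - ?c) \<odot>\<^bsub>?M\<^esub> ?x = \<zero>\<^bsub>?M\<^esub>"
      unfolding smult[OF sc] free_act_diff_left
      using vertex_sum_act[OF assms(1) x] by (simp add: s_def)
  next
    fix X assume X: "X \<in> carrier ?L" "X \<odot>\<^bsub>?M\<^esub> ?x = \<zero>\<^bsub>?M\<^esub>"
    then obtain f :: "('v, 'e, 'k) lpa_free" where f: "f \<in> augmentation E" "X = lpa_class E f"
      by (auto simp: carrier_lpa)
    then have "free_act E f ?x = 0" using X(2) smult by simp
    then obtain a where a: "a \<in> carrier (free_algebra (lpa_gens E))" "f - a * (1 - ?c) \<in> lpa_ideal E"
      using periodic_annihilator[OF wf_digraph_axioms z d F[OF f(1)]] by blast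
    have sa: "s * a \<in> augmentation E"
      using s a(1) by (simp add: augmentation_def free_algebra_mult lookup_mult_zero)
    note I = left_ideal_free[OF left_ideal_lpa_ideal[OF wf_digraph_axioms]]
    \<comment> \<open>the coefficient found in the free algebra may have a constant term; multiplying by the identity element \<open>s\<close> of the Leavitt path algebra removes it\<close>
    have "f - s * a * (s - ?c) = s * (f - a * (1 - ?c)) - (s * f - f) - (s * a * s - s * a)"
      by (simp add: algebra_simps)
    also have "\<dots> \<in> lpa_ideal E"
      unfolding s_def
      by (intro I(3) I(4)[OF _ a(2)] vertex_sum_unit[OF assms(1)] f(1) sa[unfolded s_def] F[OF s[unfolded s_def]])
    finally have "lpa_class E f = lpa_class E (s * a * (s - ?c))"
      by (intro lpa_class_eqI wf_digraph_axioms F f(1) augmentation_closed(4) sa sc)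
    then have "X = lpa_class E (s * a) \<otimes>\<^bsub>?L\<^esub> lpa_class E (s - ?c)"
      using f(2) mult_lpa[OF wf_digraph_axioms sa sc] by simp
    with sa show "\<exists>Y \<in> carrier ?L. X = Y \<otimes>\<^bsub>?L\<^esub> lpa_class E (s - ?c)"
      by (auto simp: carrier_lpa)
  qed
qed



section \<open>Paths that are not eventually periodic\<close>

text \<open>At least one edge is needed: the empty word is not congruent to a vertex.\<close>

lemma ghosts_times_path:
  fixes E :: "('v, 'e) pre_digraph"
  assumes "wf_digraph E" "q \<in> infinite_paths E" "n > 0"
  shows "word (map Ghost (rev (stake n q))) * path (stake n q) - gen (Vertex (tail E (q !! n)))
    \<in> (lpa_ideal E :: ('v, 'e, 'k::field) lpa_free set)"
  using assms(3,2)
proof (induction n arbitrary: q rule: nat_induct_non_zero)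
  case 1
  note q = infinite_pathsD[OF 1]
  show ?case using gen_times_edge(3)[OF assms(1) q(1,1)] q(3) by (simp add: word_Cons word_Nil)
next
  case (Suc n)
  note q = infinite_pathsD[OF Suc.prems]
  note I = left_ideal_free[OF left_ideal_lpa_ideal[OF assms(1)]]
  let ?G = "word (map Ghost (rev (stake n (stl q)))) :: ('v, 'e, 'k) lpa_free"
  let ?P = "path (stake n (stl q)) :: ('v, 'e, 'k) lpa_free"
  let ?v = "gen (Vertex (head E (shd q))) :: ('v, 'e, 'k) lpa_free"
  let ?d = "gen (Ghost (shd q)) * gen (Edge (shd q)) - ?v"
  have arcs: "set (stake n (stl q)) \<subseteq> arcs E" by (rule infinite_pathsD(4)[OF q(2)])
  have G: "?G \<in> carrier (free_algebra (lpa_gens E))" by (rule word_in_free_algebra) (use arcs in auto)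
  have d: "?d * ?P \<in> lpa_ideal E"
    by (rule lpa_ideal_closed(3)[OF assms(1) _ path_in_free_algebra[OF arcs]])
      (use gen_times_edge(3)[OF assms(1) q(1,1)] in simp)
  have v: "?v * ?P - ?P \<in> lpa_ideal E"
    using vertex_times_path[OF assms(1) q(2) Suc.hyps] q(3) by simp
  have "word (map Ghost (rev (stake (Suc n) q))) * path (stake (Suc n) q) - gen (Vertex (tail E (q !! Suc n)))
    = ?G * (?d * ?P + (?v * ?P - ?P)) + (?G * ?P - gen (Vertex (tail E (stl q !! n))))"
    by (simp add: word_Cons word_append word_Nil algebra_simps)
  also have "\<dots> \<in> lpa_ideal E"
    by (intro I(2) I(4)[OF G] d v Suc.IH q(2))
  finally show ?case .
qed

text \<open>The classes of the elements that already kill the first \<open>n\<close> edges of \<open>p\<close>; if \<open>p\<close> is aperiodic, these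
left ideals exhaust the annihilator of \<open>p\<close>.\<close>

definition prefix_annihilator :: "('v, 'e) pre_digraph \<Rightarrow> 'e stream \<Rightarrow> nat \<Rightarrow> ('v, 'e, 'k::field) lpa_free set set"
  where "prefix_annihilator E p n =
    lpa_class E ` {f \<in> augmentation E. f * path (stake n p) \<in> lpa_ideal E}"

lemma left_ideal_prefix_annihilator:
  fixes E :: "('v, 'e) pre_digraph"
  assumes "wf_digraph E"
  shows "left_ideal (leavitt_path_algebra E :: (('v, 'e, 'k::field) lpa_free set) ring) (prefix_annihilator E p n)"
proof -
  let ?L = "leavitt_path_algebra E :: (('v, 'e, 'k) lpa_free set) ring"
  let ?A = "{f \<in> augmentation E. f * path (stake n p) \<in> lpa_ideal E} :: ('v, 'e, 'k) lpa_free set"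
  note I = left_ideal_free[OF left_ideal_lpa_ideal[OF assms]]
  have A: "0 \<in> ?A" "\<And>f g. f \<in> ?A \<Longrightarrow> g \<in> ?A \<Longrightarrow> f + g \<in> ?A"
    "\<And>f g. f \<in> augmentation E \<Longrightarrow> g \<in> ?A \<Longrightarrow> f * g \<in> ?A"
    using I(1,2) I(4)[OF augmentationD] by (auto simp: augmentation_closed distrib_right mult.assoc)
  show ?thesis
    unfolding left_ideal_def prefix_annihilator_def
  proof (intro conjI ballI)
    show "\<zero>\<^bsub>?L\<^esub> \<in> lpa_class E ` ?A" unfolding zero_lpa[OF assms] by (rule imageI[OF A(1)])
  next
    fix X Y assume "X \<in> lpa_class E ` ?A" "Y \<in> lpa_class E ` ?A"
    then obtain f g where fg: "f \<in> ?A" "X = lpa_class E f" "g \<in> ?A" "Y = lpa_class E g" by blast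
    have "X \<oplus>\<^bsub>?L\<^esub> Y = lpa_class E (f + g)" unfolding fg by (rule add_lpa[OF assms]) (use fg in auto)
    then show "X \<oplus>\<^bsub>?L\<^esub> Y \<in> lpa_class E ` ?A" using A(2)[OF fg(1,3)] by blast
  next
    fix X Y assume "X \<in> carrier ?L" "Y \<in> lpa_class E ` ?A"
    then obtain f g where fg: "f \<in> augmentation E" "X = lpa_class E f" "g \<in> ?A" "Y = lpa_class E g"
      by (auto simp: carrier_lpa)
    have "X \<otimes>\<^bsub>?L\<^esub> Y = lpa_class E (f * g)" unfolding fg by (rule mult_lpa[OF assms]) (use fg in auto)
    then show "X \<otimes>\<^bsub>?L\<^esub> Y \<in> lpa_class E ` ?A" using A(3)[OF fg(1,3)] by blast
  qed (auto simp: carrier_lpa)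
qed

lemma prefix_annihilatorD:
  fixes f :: "('v, 'e, 'k::field) lpa_free"
  assumes "wf_digraph E" "p \<in> infinite_paths E" "f \<in> augmentation E" "lpa_class E f \<in> prefix_annihilator E p n"
  shows "f * path (stake n p) \<in> lpa_ideal E"
proof -
  let ?P = "path (stake n p) :: ('v, 'e, 'k) lpa_free"
  have P: "?P \<in> carrier (free_algebra (lpa_gens E))"
    by (rule path_in_free_algebra[OF infinite_pathsD(4)[OF assms(2)]])
  obtain g where g: "g * ?P \<in> lpa_ideal E" "lpa_class E f = lpa_class E g"
    using assms(4) by (auto simp: prefix_annihilator_def)
  have "f \<in> lpa_class E f"
    using lpa_ideal_closed(1)[OF assms(1)] by (auto simp: a_r_coset_def' intro!: bexI[of _ 0])
  then have "f \<in> lpa_class E g" by (simp only: g(2))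
  then obtain r where "r \<in> lpa_ideal E" "f = r + g" by (auto simp: a_r_coset_def')
  then show ?thesis
    using lpa_ideal_closed(2)[OF assms(1) lpa_ideal_closed(3)[OF assms(1) _ P] g(1)]
    by (simp add: distrib_right)
qed

text \<open>If \<open>p\<close> is not eventually periodic, then no path tail-equivalent to it has the same continuation after initial
segments of different lengths, so nothing beyond the ideal of relations is
needed in \<open>annihilator_times_path\<close>.\<close>

lemma aperiodic_annihilator:
  fixes E :: "('v, 'e) pre_digraph" and f :: "('v, 'e, 'k::field) lpa_free"
  assumes "wf_digraph E" "p \<in> infinite_paths E" "\<not> (\<exists>i j. i < j \<and> sdrop i p = sdrop j p)"
    and f: "f \<in> carrier (free_algebra (lpa_gens E))" "free_act E f (Poly_Mapping.single p 1) = 0"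
  shows "\<forall>\<^sub>F j in sequentially. f * path (stake j p) \<in> lpa_ideal E"
proof -
  have unique: "a = b" if "sdrop a q = sdrop j p" "sdrop b q = sdrop j p" for a b j and q :: "'e stream"
  proof -
    have no: False if "a < b" "sdrop a q = sdrop j p" "sdrop b q = sdrop j p" for a b
    proof -
      have "sdrop (j + (b - a)) p = sdrop (b - a) (sdrop a q)" using that(2) by (metis sdrop_add)
      also have "\<dots> = sdrop j p" using that by (metis sdrop_add le_add_diff_inverse less_imp_le)
      finally show False using assms(3) \<open>a < b\<close> by (metis less_add_same_cancel1 zero_less_diff)
    qed
    show ?thesis using no[of a b] no[of b a] that by (metis linorder_neqE_nat)
  qed
  have "f * path (stake j p) \<in> lpa_ideal E"
    if j: "Max ((\<lambda>w. length (letters w) + 2) ` Poly_Mapping.keys f) \<le> j" for j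
  proof (rule annihilator_times_path[OF assms(1,2) f left_ideal_lpa_ideal[OF assms(1)] subset_refl])
    fix w assume "w \<in> Poly_Mapping.keys f"
    then show "length (letters w) + 2 \<le> j" using j by (subst (asm) Max_le_iff) auto
  next
    fix q :: "'e stream" and a b
    assume "sdrop a q = sdrop j p" "sdrop b q = sdrop j p"
    then have "a = b" by (rule unique)
    then show "path (stake a q) - path (stake b q) \<in> (lpa_ideal E :: ('v, 'e, 'k) lpa_free set)"
      using lpa_ideal_closed(1)[OF assms(1)] by simp
  qed
  then show ?thesis unfolding eventually_sequentially by blast
qed

text \<open>A finite set of generators of the annihilator would be contained in one of the left ideals
\<open>prefix_annihilator E p n\<close>, with \<open>n\<close> as large as desired. Let \<open>e\<close> be the edge of \<open>p\<close> after its
first \<open>n\<close> edges and \<open>G\<close> the product of ghost edges that removes those. Then \<open>(v - e e\<^sup>*) G\<close>, where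
\<open>v\<close> is the source of \<open>e\<close>, annihilates \<open>p\<close>, but it sends the initial segment of length \<open>n\<close> to
\<open>v - e e\<^sup>*\<close>, which is non-zero when \<open>v\<close> emits a second edge.\<close>

lemma aperiodic_not_finitely_presented:
  fixes E :: "('v, 'e) pre_digraph" and p :: "'e stream"
  assumes "fin_digraph E" "p \<in> infinite_paths E" "\<not> (\<exists>i j. i < j \<and> sdrop i p = sdrop j p)"
  shows "\<not> finitely_presented (leavitt_path_algebra E :: (('v, 'e, 'k::field) lpa_free set) ring) (path_module E p)"
    (is "\<not> finitely_presented ?L ?M")
proof
  assume fp: "finitely_presented ?L ?M"
  interpret fin_digraph E by fact
  let ?x = "Poly_Mapping.single p 1 :: 'e stream \<Rightarrow>\<^sub>0 'k"
  let ?Ann = "{X \<in> carrier ?L. X \<odot>\<^bsub>?M\<^esub> ?x = \<zero>\<^bsub>?M\<^esub>}"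
  have pc: "p \<in> tail_class E p" using assms(2) by (auto simp: tail_class_def tail_equivalent_def)
  have x: "?x \<in> carrier ?M" by (rule path_module_single[OF pc])
  have smult: "lpa_class E f \<odot>\<^bsub>?M\<^esub> ?x = free_act E f ?x" if "f \<in> augmentation E" for f :: "('v, 'e, 'k) lpa_free"
    by (rule path_module_smult[OF wf_digraph_axioms augmentationD[OF that] x])
  obtain G where G: "finite G" "G \<subseteq> ?Ann" "\<And>H. left_ideal ?L H \<Longrightarrow> G \<subseteq> H \<Longrightarrow> ?Ann \<subseteq> H"
    using finitely_presented_annihilator[OF left_module_path_module[OF assms(1)] fp x
        path_module_cyclic_lpa[OF wf_digraph_axioms pc]] by blast
  have "\<forall>X\<in>G. \<forall>\<^sub>F n in sequentially. X \<in> prefix_annihilator E p n"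
  proof
    fix X assume "X \<in> G"
    with G(2) have X: "X \<in> carrier ?L" "X \<odot>\<^bsub>?M\<^esub> ?x = \<zero>\<^bsub>?M\<^esub>" by auto
    then obtain f :: "('v, 'e, 'k) lpa_free" where f: "f \<in> augmentation E" "X = lpa_class E f"
      by (auto simp: carrier_lpa)
    then have "free_act E f ?x = 0" using X(2) smult by simp
    from aperiodic_annihilator[OF wf_digraph_axioms assms(2,3) augmentationD[OF f(1)] this]
    show "\<forall>\<^sub>F n in sequentially. X \<in> prefix_annihilator E p n"
      by (rule eventually_mono) (use f in \<open>auto simp: prefix_annihilator_def\<close>)
  qed
  then have "\<forall>\<^sub>F n in sequentially. \<forall>X\<in>G. X \<in> prefix_annihilator E p n"
    by (rule eventually_ball_finite[OF G(1)])
  then obtain N where N: "\<And>n. n \<ge> N \<Longrightarrow> G \<subseteq> prefix_annihilator E p n"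
    unfolding eventually_sequentially by blast
  obtain n e' where n: "n \<ge> Suc N" and e': "e' \<in> arcs E" "tail E e' = tail E (p !! n)" "e' \<noteq> p !! n"
    using aperiodic_branches[OF assms, of "Suc N"] by blast
  have Ann: "?Ann \<subseteq> prefix_annihilator E p n"
    using G(3)[OF left_ideal_prefix_annihilator[OF wf_digraph_axioms] N] n by simp
  define e where "e = p !! n"
  have e: "e \<in> arcs E" using assms(2) by (simp add: e_def infinite_paths_def)
  let ?v = "gen (Vertex (tail E e)) :: ('v, 'e, 'k) lpa_free"
  let ?e = "gen (Edge e) :: ('v, 'e, 'k) lpa_free" and ?g = "gen (Ghost e) :: ('v, 'e, 'k) lpa_free"
  let ?G = "word (map Ghost (rev (stake n p))) :: ('v, 'e, 'k) lpa_free"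
  let ?P = "path (stake n p) :: ('v, 'e, 'k) lpa_free"
  have gens: "?v \<in> augmentation E" "?e \<in> augmentation E" "?g \<in> augmentation E"
    using e by (auto intro: augmentation_gen)
  have "?e * ?g \<in> augmentation E" using gens augmentation_closed(4) by blast
  then have d: "?v - ?e * ?g \<in> augmentation E"
    using augmentation_closed(2)[OF gens(1) augmentation_closed(3)] by fastforce
  have "?G \<in> augmentation E"
    by (rule word_augmentation) (use infinite_pathsD(4)[OF assms(2), of n] n in auto)
  then have f: "(?v - ?e * ?g) * ?G \<in> augmentation E" using d augmentation_closed(4) by blast
  have e_shd: "shd (sdrop n p) = e" by (simp add: e_def)
  have nx: "head E e = tail E (shd (stl (sdrop n p)))"
    using infinite_pathsD(3)[OF sdrop_infinite_paths[OF assms(2)], of n] by (simp only: e_shd)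
  have "free_act E ?G ?x = Poly_Mapping.single (sdrop n p) 1"
    by (simp add: free_act_single word_act_ghosts)
  then have "free_act E ((?v - ?e * ?g) * ?G) ?x = 0"
    using stream.collapse[of "sdrop n p"]
    by (simp add: free_act_mult free_act_diff_left free_act_gen e_shd nx del: sdrop_simps stream.collapse)
  then have "lpa_class E ((?v - ?e * ?g) * ?G) \<in> prefix_annihilator E p n"
    using Ann smult[OF f] f by (auto simp: carrier_lpa)
  then have "(?v - ?e * ?g) * ?G * ?P \<in> lpa_ideal E"
    by (rule prefix_annihilatorD[OF wf_digraph_axioms assms(2) f])
  moreover have "?G * ?P - ?v \<in> lpa_ideal E"
    using ghosts_times_path[OF wf_digraph_axioms assms(2), of n] n by (simp add: e_def)
  moreover have "?v * ?v - ?v \<in> lpa_ideal E" "?g * ?v - ?g \<in> lpa_ideal E"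
    by (rule lpa_relations_in_ideal[OF wf_digraph_axioms]; use e in \<open>auto simp: lpa_relations_def\<close>)+
  moreover note I = left_ideal_free[OF left_ideal_lpa_ideal[OF wf_digraph_axioms]]
  have "?v - ?e * ?g = (?v - ?e * ?g) * ?G * ?P - (?v - ?e * ?g) * (?G * ?P - ?v)
      - (?v * ?v - ?v) + ?e * (?g * ?v - ?g)"
    by (simp add: algebra_simps)
  ultimately have "?v - ?e * ?g \<in> lpa_ideal E"
    using I(2) I(3) I(4)[OF augmentationD[OF d]] I(4)[OF augmentationD[OF gens(2)]] by metis
  moreover have "?v - ?e * ?g \<notin> lpa_ideal E"
    by (rule branching_edge_not_full[OF assms(1) e e'(1)]) (use e'(2,3) in \<open>simp_all add: e_def\<close>)
  ultimately show False by blast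
qed


theorem proposition4p1:
  fixes E :: "('v, 'e) pre_digraph" and p :: "'e stream"
  assumes "fin_digraph E"
    and "p \<in> infinite_paths E"
  shows "finitely_presented
      (leavitt_path_algebra E :: (('v, 'e, 'k::field) lpa_free set) ring) (path_module E p)
    \<longleftrightarrow> (\<exists>c. wf_digraph.closed_w E c \<and> tail_equivalent p (cycle c))"
proof -
  have wf: "wf_digraph E" by (rule fin_digraph.axioms(1)[OF assms(1)])
  show ?thesis
    unfolding tail_equivalent_cycle_iff[OF wf assms(2)]
    using periodic_finitely_presented[OF assms] aperiodic_not_finitely_presented[OF assms] by blast
qed

end
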